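(* Let $\Phi$ be a Young function with $\Phi\in\nabla_2$, let $w\in A_{i_\Phi}$, and let $\varphi_1,\varphi_2$ be positive measurable functions on $\mathbb{R}^n\times(0,\infty)$ such that $\varphi_1\in\mathcal{G}^{\Phi}_w$ and, for some constant $C>0$, $$\varphi_1(x,r)\le C\,\varphi_2(x,r)\qquad\text{for all }x\in\mathbb{R}^n,\ r>0.$$ Let $T$ be a genuine Calderón–Zygmund (singular integral) operator. If $T$ is bounded from $M^{\Phi,\varphi_1}_w(\mathbb{R}^n)$ to $M^{\Phi,\varphi_2}_w(\mathbb{R}^n)$, then there is a constant $C>0$ such that $$\int_r^\infty \varphi_1(x,t)\,\frac{dt}{t}\le C\,\varphi_2(x,r)\qquad\text{for all }x\in\mathbb{R}^n,\ r>0.$$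
   Context: A Young function is a convex, left-continuous $\Phi:[0,\infty)\to[0,\infty]$ with $\lim_{r\to0^+}\Phi(r)=\Phi(0)=0$ and $\lim_{r\to\infty}\Phi(r)=\infty$. Put $\Phi^{-1}(s)=\inf\{r\ge0:\Phi(r)>s\}$ ($\inf\emptyset=\infty$). $\Phi\in\nabla_2$ means $\Phi(r)\le\frac1{2k}\Phi(kr)$ for all $r\ge0$, for some $k>1$. With $h_\Phi(t)=\sup_{s>0}\Phi(st)/\Phi(s)$, the lower dilation index is $i_\Phi=\lim_{t\to0^+}\frac{\log h_\Phi(t)}{\log t}$. Weights: for $1<p<\infty$, a locally integrable $w:\mathbb{R}^n\to[0,\infty)$ (not a.e. zero) is in $A_p$ if $\sup_B\big(\frac1{|B|}\int_Bw\big)\big(\frac1{|B|}\int_Bw^{-p'/p}\big)^{p/p'}<\infty$, supremum over all balls; $w\in A_1$ if, for some $C>0$, $\frac1{|B|}\int_Bw\le Cw(x)$ for a.e. $x\in B$, for every ball $B$; $A_\infty=\bigcup_{p\ge1}A_p$. $w(E)=\int_Ew\,dx$. Spaces: $\|f\|_{L^\Phi_w}=\inf\{\lambda>0:\int_{\mathbb{R}^n}\Phi(|f|/\lambda)w\,dx\le1\}$, $\|f\|_{L^\Phi_w(B)}=\|f\chi_B\|_{L^\Phi_w}$, and $L^{\Phi,\mathrm{loc}}_w$ is the set of measurable $f$ with $\|f\|_{L^\Phi_w(B)}<\infty$ for all balls $B$. For a positive measurable $\varphi$ on $\mathbb{R}^n\times(0,\infty)$, $M^{\Phi,\varphi}_w(\mathbb{R}^n)$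 is the set of $f\in L^{\Phi,\mathrm{loc}}_w$ with $\|f\|_{M^{\Phi,\varphi}_w}=\sup_{x\in\mathbb{R}^n,r>0}\varphi(x,r)^{-1}\Phi^{-1}\big(w(B(x,r))^{-1}\big)\|f\|_{L^\Phi_w(B(x,r))}<\infty$. Class $\mathcal{G}^\Phi_w$: writing $\varphi(B)=\varphi(x,r)$ and $r_B=r$ for $B=B(x,r)$, it consists of all $\varphi:\mathbb{R}^n\times(0,\infty)\to(0,\infty)$ for which there is $C>0$ such that for all balls $B,B_0$: $\varphi(B_0)\le C\varphi(B)$ if $r_B\le r_{B_0}$, and $\frac{\varphi(B_0)}{\Phi^{-1}(w(B_0)^{-1})}\le C\frac{\varphi(B)}{\Phi^{-1}(w(B)^{-1})}$ if $r_B\ge r_{B_0}$. Calderón–Zygmund operator: a bounded linear operator $T$ on $L^2(\mathbb{R}^n)$ for which there is a function $K$ on $\mathbb{R}^n\times\mathbb{R}^n$ such that (i) $|K(x,y)|\le C|x-y|^{-n}$ for $x\ne y$; (ii) for some $\varepsilon>0$, $C>0$, $|K(x,y)-K(z,y)|+|K(y,x)-K(y,z)|\le C\frac{|x-z|^\varepsilon}{|x-y|^{n+\varepsilon}}$ whenever $|x-y|\ge2|x-z|$, $x\ne y$; (iii) for bounded compactly supported $f$, $Tf(x)=\int_{\mathbb{R}^n}K(x,y)f(y)\,dy$ for all $x\notin\operatorname{supp}f$. It is genuine if there are $C>0$ and a cone $V=R\{x=(x',x_n)\in\mathbb{R}^n:|x'|<\theta|x_n|\}$ with $\theta>0$ and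 $R$ an orthogonal matrix, such that $K(x,y)\ge\frac{C}{|x-y|^n}$ for all $x,y$ with $x-y\in V$. Meaning of $Tf$ on these spaces: for a ball $B$ (with $2B$ the concentric ball of twice the radius) and a.e. $x\in B$, $Tf(x)=T(f\chi_{2B})(x)+\int_{\mathbb{R}^n\setminus 2B}K(x,y)f(y)\,dy$, where $f\chi_{2B}$ is integrable (since $w\in A_{i_\Phi}$) and $T(f\chi_{2B})$ is understood via the extension of $T$ from bounded compactly supported functions given by its weak type $(1,1)$ estimate (this coincides with the continuous extension of $T$ to $L^\Phi_w$ whenever the latter exists). $Tf$ is well defined if the integral converges absolutely for a.e. $x\in B$ for every ball $B$, and the functions obtained from two balls agree a.e. on their intersection. "$T$ is bounded from $X$ to $Y$" means that for every $f\in X$, $Tf$ is well defined in this sense, lies in $Y$, and $\|Tf\|_Y\le C\|f\|_X$ with $C$ independent of $f$. *)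

theory Defs
  imports "HOL-Analysis.Analysis"
begin

text \<open>
  Measurability and almost-everywhere statements refer to Lebesgue measure on \<open>real ^ 'n\<close>.  The functions
  \<open>f\<close> and the kernels \<open>K\<close> take values in a scalar field
  \<open>'k :: {real_normed_field, euclidean_space}\<close>; this covers both the real and the complex theory.
\<close>

subsection \<open>Young functions\<close>

text \<open>A function \<open>[0,\<infinity>) \<rightarrow> [0,\<infinity>]\<close> is a \<open>real \<Rightarrow> ennreal\<close> of which only the values at
  nonnegative arguments matter.\<close>

definition young_function :: "(real \<Rightarrow> ennreal) \<Rightarrow> bool" where
  "young_function \<Phi> \<longleftrightarrow>
     (\<forall>a\<ge>0. \<forall>b\<ge>0. \<forall>t\<in>{0..1}.
        \<Phi> ((1 - t) * a + t * b) \<le> ennreal (1 - t) * \<Phi> a + ennreal t * \<Phi> b) \<and>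
     (\<forall>r>0. continuous (at_left r) \<Phi>) \<and>
     \<Phi> 0 = 0 \<and> (\<Phi> \<longlongrightarrow> 0) (at_right 0) \<and> (\<Phi> \<longlongrightarrow> \<infinity>) at_top"

definition young_inv :: "(real \<Rightarrow> ennreal) \<Rightarrow> ennreal \<Rightarrow> ennreal" where
  "young_inv \<Phi> s = (INF r\<in>{r. 0 \<le> r \<and> \<Phi> r > s}. ennreal r)"

definition nabla2 :: "(real \<Rightarrow> ennreal) \<Rightarrow> bool" where
  "nabla2 \<Phi> \<longleftrightarrow> (\<exists>k>1. \<forall>r\<ge>0. \<Phi> r \<le> ennreal (1 / (2 * k)) * \<Phi> (k * r))"

text \<open>The quotients \<open>0 / 0\<close> and \<open>\<infinity> / \<infinity>\<close> are \<open>0\<close> in \<^typ>\<open>ennreal\<close>, so that for \<open>0 < t < 1\<close>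
  the supremum is the infimum of all \<open>C > 0\<close> with \<open>\<Phi> (s * t) \<le> C * \<Phi> s\<close> for all \<open>s > 0\<close>.\<close>

definition dilation_fun :: "(real \<Rightarrow> ennreal) \<Rightarrow> real \<Rightarrow> ennreal" where
  "dilation_fun \<Phi> t = (SUP s\<in>{0<..}. \<Phi> (s * t) / \<Phi> s)"

definition log_ennreal :: "ennreal \<Rightarrow> ereal" where
  "log_ennreal a = (if a = 0 then - \<infinity> else if a = \<infinity> then \<infinity> else ereal (ln (enn2real a)))"

definition lower_dilation_index :: "(real \<Rightarrow> ennreal) \<Rightarrow> ereal" where
  "lower_dilation_index \<Phi> =
     Lim (at_right 0) (\<lambda>t. log_ennreal (dilation_fun \<Phi> t) / ereal (ln t))"

subsection \<open>Weights\<close>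

definition ennreal_powr :: "ennreal \<Rightarrow> real \<Rightarrow> ennreal" where
  "ennreal_powr a q =
     (if q = 0 then 1
      else if a = 0 then (if q < 0 then \<infinity> else 0)
      else if a = \<infinity> then (if q < 0 then 0 else \<infinity>)
      else ennreal (enn2real a powr q))"

definition is_weight :: "(real ^ 'n \<Rightarrow> real) \<Rightarrow> bool" where
  "is_weight w \<longleftrightarrow> (\<forall>x. 0 \<le> w x) \<and> (\<forall>S. compact S \<longrightarrow> w absolutely_integrable_on S) \<and>
     \<not> (AE x in lebesgue. w x = 0)"

definition ball_average :: "(real ^ 'n) set \<Rightarrow> (real ^ 'n \<Rightarrow> ennreal) \<Rightarrow> ennreal" where
  "ball_average B g = (\<integral>\<^sup>+ x\<in>B. g x \<partial>lebesgue) / emeasure lebesgue B"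

text \<open>With \<open>p' = p / (p - 1)\<close> one has \<open>p' / p = 1 / (p - 1)\<close> and \<open>p / p' = p - 1\<close>.\<close>

definition A_p :: "real \<Rightarrow> (real ^ 'n \<Rightarrow> real) \<Rightarrow> bool" where
  "A_p p w \<longleftrightarrow> is_weight w \<and>
     (SUP (x, r)\<in>UNIV \<times> {0<..}.
        ball_average (ball x r) (\<lambda>y. ennreal (w y)) *
        ennreal_powr (ball_average (ball x r) (\<lambda>y. ennreal_powr (ennreal (w y)) (- (1 / (p - 1)))))
          (p - 1)) < \<infinity>"

definition A_1 :: "(real ^ 'n \<Rightarrow> real) \<Rightarrow> bool" where
  "A_1 w \<longleftrightarrow> is_weight w \<and>
     (\<exists>C>0. \<forall>x. \<forall>r>0. AE y in lebesgue. y \<in> ball x r \<longrightarrow>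
        ball_average (ball x r) (\<lambda>z. ennreal (w z)) \<le> ennreal (C * w y))"

definition A_infty :: "(real ^ 'n \<Rightarrow> real) \<Rightarrow> bool" where
  "A_infty w \<longleftrightarrow> A_1 w \<or> (\<exists>p>1. A_p p w)"

definition muckenhoupt :: "ereal \<Rightarrow> (real ^ 'n \<Rightarrow> real) \<Rightarrow> bool" where
  "muckenhoupt p w \<longleftrightarrow>
     (p = 1 \<and> A_1 w) \<or> (\<exists>q>1. p = ereal q \<and> A_p q w) \<or> (p = \<infinity> \<and> A_infty w)"

definition wmeas :: "(real ^ 'n \<Rightarrow> real) \<Rightarrow> (real ^ 'n) set \<Rightarrow> ennreal" where
  "wmeas w E = (\<integral>\<^sup>+ x\<in>E. ennreal (w x) \<partial>lebesgue)"

subsection \<open>Weighted Orlicz and generalized Orlicz--Morrey spaces\<close>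

definition restr :: "'a set \<Rightarrow> ('a \<Rightarrow> 'k::real_vector) \<Rightarrow> 'a \<Rightarrow> 'k" where
  "restr E f = (\<lambda>x. indicator E x *\<^sub>R f x)"

definition orlicz_norm ::
    "(real \<Rightarrow> ennreal) \<Rightarrow> (real ^ 'n \<Rightarrow> real) \<Rightarrow> (real ^ 'n \<Rightarrow> 'k::real_normed_vector) \<Rightarrow> ennreal" where
  "orlicz_norm \<Phi> w f =
     (INF l\<in>{l. 0 < l \<and> (\<integral>\<^sup>+ x. \<Phi> (norm (f x) / l) * ennreal (w x) \<partial>lebesgue) \<le> 1}. ennreal l)"

definition orlicz_loc ::
    "(real \<Rightarrow> ennreal) \<Rightarrow> (real ^ 'n \<Rightarrow> real) \<Rightarrow> (real ^ 'n \<Rightarrow> 'k::real_normed_vector) set" where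
  "orlicz_loc \<Phi> w = {f. f \<in> borel_measurable lebesgue \<and>
     (\<forall>x. \<forall>r>0. orlicz_norm \<Phi> w (restr (ball x r) f) < \<infinity>)}"

definition morrey_norm ::
    "(real \<Rightarrow> ennreal) \<Rightarrow> (real ^ 'n \<Rightarrow> real \<Rightarrow> real) \<Rightarrow> (real ^ 'n \<Rightarrow> real)
      \<Rightarrow> (real ^ 'n \<Rightarrow> 'k::real_normed_vector) \<Rightarrow> ennreal" where
  "morrey_norm \<Phi> \<phi> w f =
     (SUP (x, r)\<in>UNIV \<times> {0<..}.
        ennreal (inverse (\<phi> x r)) * young_inv \<Phi> (inverse (wmeas w (ball x r))) *
        orlicz_norm \<Phi> w (restr (ball x r) f))"

definition morrey_space ::
    "(real \<Rightarrow> ennreal) \<Rightarrow> (real ^ 'n \<Rightarrow> real \<Rightarrow> real) \<Rightarrow> (real ^ 'n \<Rightarrow> real)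
      \<Rightarrow> (real ^ 'n \<Rightarrow> 'k::real_normed_vector) set" where
  "morrey_space \<Phi> \<phi> w = {f \<in> orlicz_loc \<Phi> w. morrey_norm \<Phi> \<phi> w f < \<infinity>}"

text \<open>A function on \<open>\<real>\<^sup>n \<times> (0,\<infinity>)\<close> is curried, with only its values at positive second
  arguments being relevant.\<close>

definition positive_measurable :: "(real ^ 'n \<Rightarrow> real \<Rightarrow> real) \<Rightarrow> bool" where
  "positive_measurable \<phi> \<longleftrightarrow> (\<forall>x. \<forall>r>0. 0 < \<phi> x r) \<and>
     (\<lambda>(x, r). \<phi> x r) \<in> borel_measurable (lebesgue_on (UNIV \<times> {0<..}))"

definition class_G ::
    "(real \<Rightarrow> ennreal) \<Rightarrow> (real ^ 'n \<Rightarrow> real) \<Rightarrow> (real ^ 'n \<Rightarrow> real \<Rightarrow> real) set" where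
  "class_G \<Phi> w = {\<phi>. (\<forall>x. \<forall>r>0. 0 < \<phi> x r) \<and>
     (\<exists>C>0. \<forall>x x0. \<forall>r>0. \<forall>r0>0.
        (r \<le> r0 \<longrightarrow> \<phi> x0 r0 \<le> C * \<phi> x r) \<and>
        (r \<ge> r0 \<longrightarrow>
           ennreal (\<phi> x0 r0) / young_inv \<Phi> (inverse (wmeas w (ball x0 r0)))
             \<le> ennreal C * (ennreal (\<phi> x r) / young_inv \<Phi> (inverse (wmeas w (ball x r))))))}"

subsection \<open>Calderon--Zygmund operators\<close>

definition L2 :: "(real ^ 'n \<Rightarrow> 'k::real_normed_vector) set" where
  "L2 = {f. f \<in> borel_measurable lebesgue \<and>
     (\<integral>\<^sup>+ x. ennreal ((norm (f x))\<^sup>2) \<partial>lebesgue) < \<infinity>}"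

text \<open>An operator on the space of classes \<open>L\<^sup>2\<close> is given by a map on representatives.  That it
  respects almost-everywhere equality follows from additivity and boundedness.\<close>

definition bounded_linear_L2 ::
    "((real ^ 'n \<Rightarrow> 'k::{real_normed_field, euclidean_space}) \<Rightarrow> (real ^ 'n \<Rightarrow> 'k)) \<Rightarrow> bool" where
  "bounded_linear_L2 T \<longleftrightarrow>
     (\<forall>f\<in>L2. T f \<in> L2) \<and>
     (\<forall>f\<in>L2. \<forall>g\<in>L2. AE x in lebesgue. T (\<lambda>y. f y + g y) x = T f x + T g x) \<and>
     (\<forall>c. \<forall>f\<in>L2. AE x in lebesgue. T (\<lambda>y. c * f y) x = c * T f x) \<and>
     (\<exists>C\<ge>0. \<forall>f\<in>L2. (\<integral>\<^sup>+ x. ennreal ((norm (T f x))\<^sup>2) \<partial>lebesgue)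
        \<le> ennreal (C\<^sup>2) * (\<integral>\<^sup>+ x. ennreal ((norm (f x))\<^sup>2) \<partial>lebesgue))"

definition fsupp :: "('a::topological_space \<Rightarrow> 'k::zero) \<Rightarrow> 'a set" where
  "fsupp f = closure {x. f x \<noteq> 0}"

definition bounded_cpt :: "(real ^ 'n \<Rightarrow> 'k::{real_normed_field, euclidean_space}) set" where
  "bounded_cpt = {f. f \<in> borel_measurable lebesgue \<and> bounded (range f) \<and> compact (fsupp f)}"

text \<open>The kernel representation is required almost everywhere off the support, as \<open>T f\<close> is only
  determined almost everywhere.\<close>

definition calderon_zygmund ::
    "((real ^ 'n \<Rightarrow> 'k::{real_normed_field, euclidean_space}) \<Rightarrow> (real ^ 'n \<Rightarrow> 'k))
      \<Rightarrow> (real ^ 'n \<Rightarrow> real ^ 'n \<Rightarrow> 'k) \<Rightarrow> bool" where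
  "calderon_zygmund T K \<longleftrightarrow>
     bounded_linear_L2 T \<and>
     (\<exists>C. \<forall>x y. x \<noteq> y \<longrightarrow> norm (K x y) \<le> C / norm (x - y) ^ CARD('n)) \<and>
     (\<exists>\<epsilon>>0. \<exists>C>0. \<forall>x y z. x \<noteq> y \<and> norm (x - y) \<ge> 2 * norm (x - z) \<longrightarrow>
        norm (K x y - K z y) + norm (K y x - K y z)
          \<le> C * (norm (x - z) powr \<epsilon> / norm (x - y) powr (real CARD('n) + \<epsilon>))) \<and>
     (\<forall>f\<in>bounded_cpt. AE x in lebesgue. x \<notin> fsupp f \<longrightarrow>
        T f x = (\<integral>y. K x y * f y \<partial>lebesgue))"

text \<open>The distinguished coordinate \<open>k\<close> plays the role of the last one; the choice is immaterial
  because of the orthogonal matrix \<open>R\<close>.\<close>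

definition cone :: "'n \<Rightarrow> real \<Rightarrow> real ^ 'n ^ 'n \<Rightarrow> (real ^ 'n) set" where
  "cone k \<theta> R = (\<lambda>v. R *v v) ` {v. norm (\<chi> i. if i = k then 0 else v $ i) < \<theta> * \<bar>v $ k\<bar>}"

definition genuine_kernel :: "(real ^ 'n \<Rightarrow> real ^ 'n \<Rightarrow> 'k::real_normed_field) \<Rightarrow> bool" where
  "genuine_kernel K \<longleftrightarrow>
     (\<exists>C>0. \<exists>\<theta>>0. \<exists>R k. orthogonal_matrix R \<and>
        (\<forall>x y. x - y \<in> cone k \<theta> R \<longrightarrow>
           (\<exists>a. K x y = of_real a \<and> C / norm (x - y) ^ CARD('n) \<le> a)))"

subsection \<open>Action on Orlicz--Morrey spaces\<close>

definition weak_L1_norm :: "(real ^ 'n \<Rightarrow> 'k::real_normed_vector) \<Rightarrow> ennreal" where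
  "weak_L1_norm f = (SUP t\<in>{0<..}. ennreal t * emeasure lebesgue {x. t < norm (f x)})"

text \<open>\<open>h\<close> is the value at \<open>u \<in> L\<^sup>1\<close> of the extension of \<open>T\<close> by continuity from \<open>L\<^sup>1\<close> to weak
  \<open>L\<^sup>1\<close>; it is determined almost everywhere.\<close>

definition weak_ext ::
    "((real ^ 'n \<Rightarrow> 'k::{real_normed_field, euclidean_space}) \<Rightarrow> (real ^ 'n \<Rightarrow> 'k))
      \<Rightarrow> (real ^ 'n \<Rightarrow> 'k) \<Rightarrow> (real ^ 'n \<Rightarrow> 'k) \<Rightarrow> bool" where
  "weak_ext T u h \<longleftrightarrow> integrable lebesgue u \<and> h \<in> borel_measurable lebesgue \<and>
     (\<forall>g :: nat \<Rightarrow> real ^ 'n \<Rightarrow> 'k.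
        (\<forall>m. g m \<in> bounded_cpt) \<and>
        (\<lambda>m. \<integral>\<^sup>+ x. ennreal (norm (g m x - u x)) \<partial>lebesgue) \<longlonglongrightarrow> 0 \<longrightarrow>
        (\<lambda>m. weak_L1_norm (\<lambda>x. T (g m) x - h x)) \<longlonglongrightarrow> 0)"

text \<open>\<open>T f\<close> is well defined and equal to \<open>F\<close> almost everywhere: on every ball \<open>F\<close> coincides with
  the function which the ball yields, so that the functions yielded by two balls agree almost
  everywhere on the intersection.\<close>

definition cz_image ::
    "((real ^ 'n \<Rightarrow> 'k::{real_normed_field, euclidean_space}) \<Rightarrow> (real ^ 'n \<Rightarrow> 'k))
      \<Rightarrow> (real ^ 'n \<Rightarrow> real ^ 'n \<Rightarrow> 'k) \<Rightarrow> (real ^ 'n \<Rightarrow> 'k) \<Rightarrow> (real ^ 'n \<Rightarrow> 'k) \<Rightarrow> bool" where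
  "cz_image T K f F \<longleftrightarrow>
     (\<forall>x0. \<forall>r>0. \<exists>h. weak_ext T (restr (ball x0 (2 * r)) f) h \<and>
        (AE x in lebesgue. x \<in> ball x0 r \<longrightarrow>
           set_integrable lebesgue (- ball x0 (2 * r)) (\<lambda>y. K x y * f y) \<and>
           F x = h x + (LINT y:- ball x0 (2 * r)|lebesgue. K x y * f y)))"

definition cz_bounded_morrey ::
    "((real ^ 'n \<Rightarrow> 'k::{real_normed_field, euclidean_space}) \<Rightarrow> (real ^ 'n \<Rightarrow> 'k))
      \<Rightarrow> (real ^ 'n \<Rightarrow> real ^ 'n \<Rightarrow> 'k) \<Rightarrow> (real \<Rightarrow> ennreal) \<Rightarrow> (real ^ 'n \<Rightarrow> real)
      \<Rightarrow> (real ^ 'n \<Rightarrow> real \<Rightarrow> real) \<Rightarrow> (real ^ 'n \<Rightarrow> real \<Rightarrow> real) \<Rightarrow> bool" where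
  "cz_bounded_morrey T K \<Phi> w \<phi>1 \<phi>2 \<longleftrightarrow>
     (\<exists>C\<ge>0. \<forall>f\<in>morrey_space \<Phi> \<phi>1 w. \<exists>F.
        cz_image T K f F \<and> F \<in> morrey_space \<Phi> \<phi>2 w \<and>
        morrey_norm \<Phi> \<phi>2 w F \<le> ennreal C * morrey_norm \<Phi> \<phi>1 w f)"

end

theory Submission
  imports Defs
begin

text \<open>
  Test \<open>T\<close> on a lacunary function.  Fix a ball \<open>B(x,r)\<close>, let \<open>e\<close> be the axis of the cone and \<open>R = r / \<kappa>\<close>
  with a small \<open>\<kappa>\<close>.  Let \<open>f\<close> have the value \<open>b\<^sub>j = \<phi>1(x, 4\<^sup>jR)\<close> on the ball \<open>Q\<^sub>j = B(x - 2\<^sup>jRe, \<kappa>2\<^sup>jR)\<close>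
  for \<open>j \<ge> 1\<close> (the formal index \<open>j\<close> starts at 0 and stands for \<open>j + 1\<close>), and vanish elsewhere.
  For points of \<open>B(x,r)\<close> the kernel is positive and at least a constant times \<open>1 / |Q\<^sub>j|\<close> on \<open>Q\<^sub>j\<close>, so \<open>|T f| \<ge> c \<Sum>\<^sub>j b\<^sub>j\<close> there, and this sum controls \<open>\<integral> \<phi>1(x,t) dt/t\<close> because \<open>\<phi>1\<close> is
  almost decreasing.

  What matters is that \<open>Q\<^sub>j\<close> lies at distance \<open>2\<^sup>jR\<close> and not \<open>4\<^sup>jR\<close>, the radius at which \<open>\<phi>1\<close> is evaluated.
  The class condition bounds \<open>\<Phi>(f / \<dots>)\<close> on \<open>Q\<^sub>j\<close> by a multiple of \<open>1 / w(B(x,4\<^sup>jR))\<close>, while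
  \<open>w(Q\<^sub>j) \<le> w(B(x,2\<^sup>j\<^sup>+\<^sup>1R))\<close>; by reverse doubling the quotients decay geometrically.  Thus the Morrey norm
  of \<open>f\<close> is bounded uniformly in \<open>x\<close> and \<open>r\<close>, although \<open>\<Phi>\<close> need not satisfy a doubling condition.
\<close>

section \<open>Young functions\<close>

text \<open>Convexity on the segment from \<open>0\<close> to \<open>a\<close>, where
  \<open>\<Phi>\<close> starts at \<open>0\<close>. Monotonicity and, later, the gain of a small
  factor both come from this.\<close>

lemma young_scale:
  assumes "young_function \<Phi>" "0 \<le> t" "t \<le> 1" "0 \<le> a"
  shows "\<Phi> (t * a) \<le> ennreal t * \<Phi> a"
proof -
  have "\<Phi> ((1 - t) * 0 + t * a) \<le> ennreal (1 - t) * \<Phi> 0 + ennreal t * \<Phi> a"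
    using assms unfolding young_function_def by (auto simp del: mult_zero_right)
  moreover have "\<Phi> 0 = 0" using assms unfolding young_function_def by auto
  ultimately show ?thesis by simp
qed

lemma young_mono:
  assumes "young_function \<Phi>" "0 \<le> a" "a \<le> b"
  shows "\<Phi> a \<le> \<Phi> b"
proof (cases "b = 0")
  case False
  have "\<Phi> (a / b * b) \<le> ennreal (a / b) * \<Phi> b"
    using assms False by (intro young_scale) (auto simp: divide_simps)
  also have "\<dots> \<le> 1 * \<Phi> b" 
    using assms False by (intro mult_right_mono) (auto simp: divide_simps)
  finally show ?thesis using False by simp
qed (use assms in auto)

lemma young_inv_geI:
  assumes "young_function \<Phi>" "0 \<le> a" "\<Phi> a \<le> s"
  shows "ennreal a \<le> young_inv \<Phi> s"
  unfolding young_inv_def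
proof (rule INF_greatest, rule ennreal_leI)
  fix r assume "r \<in> {r. 0 \<le> r \<and> s < \<Phi> r}"
  then have r: "0 \<le> r" "s < \<Phi> r" by auto
  show "a \<le> r"
  proof (rule ccontr)
    assume "\<not> a \<le> r"
    then have "\<Phi> r \<le> \<Phi> a" using young_mono[OF assms(1) r(1)] by simp
    with r assms show False by (meson leD order_trans)
  qed
qed

text \<open>Together with \<open>young_inv_geI\<close> this makes \<open>\<Phi>\<close> and
  \<open>young_inv \<Phi>\<close> adjoint to each other. An argument strictly below \<open>a\<close>
  lies below the infimum and so obeys the bound; left continuity carries it to \<open>a\<close>
  itself, even if \<open>\<Phi>\<close> jumps there.\<close>

lemma young_le_of_le_inv:
  assumes Y: "young_function \<Phi>" and "0 \<le> a" "ennreal a \<le> young_inv \<Phi> s"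
  shows "\<Phi> a \<le> s"
proof (cases "a = 0")
  case False
  then have a: "a > 0" using assms by simp
  have lt: "\<Phi> b \<le> s" if "0 \<le> b" "b < a" for b
  proof (rule ccontr)
    assume "\<not> \<Phi> b \<le> s"
    then have "young_inv \<Phi> s \<le> ennreal b"
      unfolding young_inv_def using that by (intro INF_lower) auto
    with assms that show False by (meson ennreal_less_iff leD order_trans)
  qed
  have "(\<Phi> \<longlongrightarrow> \<Phi> a) (at_left a)"
    using Y a unfolding young_function_def continuous_within by auto
  then show ?thesis
  proof (rule tendsto_upperbound)
    show "\<forall>\<^sub>F i in at_left a. \<Phi> i \<le> s"
      using a lt unfolding eventually_at_left_field by (intro exI[of _ 0]) auto
  qed auto
qed (use Y in \<open>auto simp: young_function_def\<close>)

lemma young_inv_pos: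
  assumes Y: "young_function \<Phi>" and "0 < s"
  shows "0 < young_inv \<Phi> s"
proof -
  have "(\<Phi> \<longlongrightarrow> 0) (at_right 0)" using Y by (auto simp: young_function_def)
  then have "\<forall>\<^sub>F r in at_right 0. \<Phi> r < s" using assms(2) by (rule order_tendstoD)
  then obtain b where b: "b > 0" "\<And>r. 0 < r \<Longrightarrow> r < b \<Longrightarrow> \<Phi> r < s"
    unfolding eventually_at_right_field by auto
  have "ennreal (b / 2) \<le> young_inv \<Phi> s"
    using b(1) b(2)[of "b/2"] by (intro young_inv_geI[OF Y]) auto
  moreover have "0 < ennreal (b / 2)" using b(1) by simp
  ultimately show ?thesis by (rule less_le_trans[rotated])
qed

lemma young_inv_finite:
  assumes Y: "young_function \<Phi>" and "s < \<infinity>"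
  shows "young_inv \<Phi> s < \<infinity>"
proof -
  have "(\<Phi> \<longlongrightarrow> \<infinity>) at_top" using Y by (auto simp: young_function_def)
  then have "\<forall>\<^sub>F r in at_top. s < \<Phi> r" using assms(2) by (rule order_tendstoD)
  then obtain b where b: "\<And>r. b \<le> r \<Longrightarrow> s < \<Phi> r" unfolding eventually_at_top_linorder by auto
  have "young_inv \<Phi> s \<le> ennreal (max b 0)"
    unfolding young_inv_def using b by (intro INF_lower) auto
  also have "\<dots> < \<infinity>" by simp
  finally show ?thesis .
qed

section \<open>Weights as measures: measurability, finiteness on balls, volumes\<close>

lemma is_weight_measurable:
  fixes w :: "real ^ 'n \<Rightarrow> real"
  assumes "is_weight w"
  shows "w \<in> borel_measurable lebesgue"
proof (rule borel_measurable_LIMSEQ_real)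
  \<comment> \<open>Local integrability makes the truncations to closed balls measurable; at each
    point they are eventually equal to \<open>w\<close>.\<close>
  fix i :: nat
  have "w absolutely_integrable_on (cball 0 (real i))"
    using assms by (auto simp: is_weight_def)
  then show "(\<lambda>x. indicator (cball 0 (real i)) x * w x) \<in> borel_measurable lebesgue"
    unfolding set_integrable_def by (auto dest: borel_measurable_integrable)
next
  fix x :: "real ^ 'n"
  obtain N where N: "norm x \<le> real N" using real_arch_simple by blast
  have "\<forall>\<^sub>F i in sequentially. indicator (cball 0 (real i)) x * w x = w x"
    using eventually_ge_at_top[of N] by eventually_elim (use N in \<open>auto simp: indicator_def\<close>)
  then show "(\<lambda>i. indicator (cball 0 (real i)) x * w x) \<longlonglongrightarrow> w x"
    by (rule tendsto_eventually)
qed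

lemma wmeas_ball_finite:
  fixes w :: "real ^ 'n \<Rightarrow> real"
  assumes "is_weight w"
  shows "wmeas w (ball x r) < \<infinity>"
proof -
  have "set_integrable lebesgue (cball x r) w" using assms by (auto simp: is_weight_def)
  then have "(\<integral>\<^sup>+ y. ennreal (norm (indicator (cball x r) y *\<^sub>R w y)) \<partial>lebesgue) < \<infinity>"
    unfolding set_integrable_def integrable_iff_bounded by auto
  moreover have "wmeas w (ball x r) \<le> (\<integral>\<^sup>+ y. ennreal (norm (indicator (cball x r) y *\<^sub>R w y)) \<partial>lebesgue)"
    unfolding wmeas_def by (intro nn_integral_mono) (auto simp: indicator_def)
  ultimately show ?thesis by (rule le_less_trans[rotated])
qed

lemma wmeas_mono:
  "A \<subseteq> B \<Longrightarrow> wmeas w A \<le> wmeas w B"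
  unfolding wmeas_def by (intro nn_integral_mono) (auto simp: indicator_def)

lemma ball_in_sets_lebesgue [measurable]: "ball (x :: real ^ 'n) r \<in> sets lebesgue"
  by simp

lemma emeasure_lebesgue_ball:
  "0 \<le> r \<Longrightarrow> emeasure lebesgue (ball (x :: real ^ 'n) r) = ennreal (unit_ball_vol (CARD('n)) * r ^ CARD('n))"
  using emeasure_ball[of r x] by simp

section \<open>Reverse doubling of Muckenhoupt weights\<close>

text \<open>The pointwise \<open>A_1\<close> bound is integrated over \<open>E\<close>: the average
  of \<open>w\<close> over the ball times the measure of \<open>E\<close> is at most
  \<open>C\<close> times \<open>wmeas w E\<close>, and \<open>E\<close> fills a proportion
  \<open>\<eta>\<close> of the ball.\<close>

lemma A_1_wmeas_subset_ge:
  fixes w :: "real ^ 'n \<Rightarrow> real"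
  assumes "A_1 w" "0 < \<eta>"
  shows "\<exists>c>0. \<forall>x. \<forall>r>0. \<forall>E\<in>sets lebesgue. E \<subseteq> ball x r \<longrightarrow>
           ennreal \<eta> * emeasure lebesgue (ball x r) \<le> emeasure lebesgue E \<longrightarrow>
           ennreal c * wmeas w (ball x r) \<le> wmeas w E"
proof -
  from assms obtain C where C: "C > 0" and wt: "is_weight w" and
    A: "\<And>x r. r > 0 \<Longrightarrow> AE y in lebesgue. y \<in> ball x r \<longrightarrow>
        ball_average (ball x r) (\<lambda>z. ennreal (w z)) \<le> ennreal (C * w y)"
    unfolding A_1_def by blast
  have [measurable]: "w \<in> borel_measurable lebesgue" by (rule is_weight_measurable[OF wt])
  have "ennreal (\<eta> / C) * wmeas w (ball x r) \<le> wmeas w E"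
    if r: "r > 0" and E[measurable]: "E \<in> sets lebesgue" and sub: "E \<subseteq> ball x r"
      and big: "ennreal \<eta> * emeasure lebesgue (ball x r) \<le> emeasure lebesgue E" for x r E
  proof -
    define b where "b = unit_ball_vol (CARD('n)) * r ^ CARD('n)"
    have b: "b > 0" using r by (simp add: b_def)
    have eb: "emeasure lebesgue (ball x r) = ennreal b"
      using emeasure_lebesgue_ball[of r x] r by (simp add: b_def)
    define m where "m = wmeas w (ball x r)"
    have avg: "ball_average (ball x r) (\<lambda>z. ennreal (w z)) = m / ennreal b"
      unfolding ball_average_def m_def wmeas_def eb ..
    have "(m / ennreal b) * emeasure lebesgue E = (\<integral>\<^sup>+ y. (m / ennreal b) * indicator E y \<partial>lebesgue)"
      by (rule nn_integral_cmult_indicator[symmetric]) measurable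
    also have "\<dots> \<le> (\<integral>\<^sup>+ y. ennreal C * (ennreal (w y) * indicator E y) \<partial>lebesgue)"
    proof (rule nn_integral_mono_AE)
      show "AE y in lebesgue. m / ennreal b * indicator E y \<le> ennreal C * (ennreal (w y) * indicator E y)"
        using A[OF r, of x]
      proof eventually_elim
        case (elim y)
        then show ?case using sub C avg by (auto simp: indicator_def ennreal_mult')
      qed
    qed
    also have "\<dots> = ennreal C * wmeas w E"
      unfolding wmeas_def by (rule nn_integral_cmult) measurable
    finally have 1: "(m / ennreal b) * emeasure lebesgue E \<le> ennreal C * wmeas w E" .
    have "ennreal \<eta> * m = (m / ennreal b) * (ennreal \<eta> * ennreal b)"
      using b by (simp add: ennreal_divide_times divide_ennreal mult_ac ennreal_times_divide
          mult_divide_eq_ennreal)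
    also have "\<dots> \<le> (m / ennreal b) * emeasure lebesgue E"
      using big eb by (intro mult_left_mono) auto
    finally have 2: "ennreal \<eta> * m \<le> ennreal C * wmeas w E" using 1 by order
    have "ennreal (\<eta> / C) * m = ennreal (1 / C) * (ennreal \<eta> * m)"
      using C \<open>\<eta> > 0\<close> by (simp flip: ennreal_mult mult.assoc)
    also have "\<dots> \<le> ennreal (1 / C) * (ennreal C * wmeas w E)"
      using 2 by (intro mult_left_mono) auto
    also have "\<dots> = wmeas w E"
      using C by (simp flip: ennreal_mult mult.assoc)
    finally show ?thesis unfolding m_def .
  qed
  then show ?thesis using C \<open>\<eta> > 0\<close> by (intro exI[of _ "\<eta> / C"]) auto
qed

text \<open>The dual weight \<open>v\<close> has average \<open>s\<close> on the ball, so it exceeds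
  a large multiple of \<open>s\<close> only on a small set. On the rest of \<open>E\<close> the
  weight \<open>w\<close> is at least a constant times the power \<open>-(p - 1)\<close> of
  \<open>s\<close>, and the \<open>A_p\<close> condition bounds the average of \<open>w\<close> over
  the whole ball by a multiple of that same power.\<close>

lemma A_p_wmeas_subset_ge:
  fixes w :: "real ^ 'n \<Rightarrow> real"
  assumes "A_p p w" "1 < p" "0 < \<eta>"
  shows "\<exists>c>0. \<forall>x. \<forall>r>0. \<forall>E\<in>sets lebesgue. E \<subseteq> ball x r \<longrightarrow>
           ennreal \<eta> * emeasure lebesgue (ball x r) \<le> emeasure lebesgue E \<longrightarrow>
           ennreal c * wmeas w (ball x r) \<le> wmeas w E"
proof -
  define v where "v = (\<lambda>y. ennreal_powr (ennreal (w y)) (- (1 / (p - 1))))"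
  have wt: "is_weight w" using assms unfolding A_p_def by blast
  have w0: "w y \<ge> 0" for y using wt by (auto simp: is_weight_def)
  have [measurable]: "w \<in> borel_measurable lebesgue" by (rule is_weight_measurable[OF wt])
  \<comment> \<open>A zero of \<open>w\<close> gives \<open>v\<close> the value \<infinity>. Hence
    \<open>v\<close> vanishes nowhere, and a finite bound on \<open>v y\<close> forces
    \<open>w y\<close> to be positive.\<close>
  have v: "v y = (if w y = 0 then \<infinity> else ennreal (w y powr - (1 / (p - 1))))" for y
    using w0[of y] assms by (auto simp: v_def ennreal_powr_def)
  have [measurable]: "v \<in> borel_measurable lebesgue"
    unfolding v[abs_def] by measurable
  have v0: "v y \<noteq> 0" for y using w0[of y] by (auto simp: v)
  define S where "S = (SUP (x, r)\<in>UNIV \<times> {0<..}.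
        ball_average (ball x r) (\<lambda>y. ennreal (w y)) * ennreal_powr (ball_average (ball x r) v) (p - 1))"
  have "S < \<infinity>" using assms unfolding A_p_def S_def v_def by blast
  then obtain A where A: "A > 0" "S \<le> ennreal A"
    by (cases S) (auto intro: that[of "enn2real S + 1"] simp: ennreal_leI)
  \<comment> \<open>Lower bound for \<open>w\<close> off the exceptional set, times half the
    proportion \<open>\<eta>\<close>, divided by the \<open>A_p\<close> constant; the powers of
    \<open>s\<close> cancel.\<close>
  define c where "c = (2 / \<eta>) powr (- (p - 1)) * \<eta> / (2 * A)"
  have c: "c > 0" using A assms by (simp add: c_def)
  have "ennreal c * wmeas w (ball x r) \<le> wmeas w E"
    if r: "r > 0" and E[measurable]: "E \<in> sets lebesgue" and sub: "E \<subseteq> ball x r"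
      and big: "ennreal \<eta> * emeasure lebesgue (ball x r) \<le> emeasure lebesgue E" for x r E
  proof (cases "wmeas w (ball x r) = 0")
    case False
    define b where "b = unit_ball_vol (CARD('n)) * r ^ CARD('n)"
    have b: "b > 0" using r by (simp add: b_def)
    have eb: "emeasure lebesgue (ball x r) = ennreal b"
      using emeasure_lebesgue_ball[of r x] r by (simp add: b_def)
    obtain m where m: "m \<ge> 0" "wmeas w (ball x r) = ennreal m"
      using wmeas_ball_finite[OF wt, of x r] by (cases "wmeas w (ball x r)") auto
    have "m > 0" using m False by (cases "m = 0") auto
    have avg_w: "ball_average (ball x r) (\<lambda>y. ennreal (w y)) = ennreal (m / b)"
      unfolding ball_average_def eb wmeas_def[symmetric] m(2) using m b by (simp add: divide_ennreal)
    define \<sigma> where "\<sigma> = ball_average (ball x r) v"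
    have "ennreal (m / b) * ennreal_powr \<sigma> (p - 1) \<le> S"
      unfolding S_def
      by (rule SUP_upper2[of "(x, r)"])
         (use r m b in \<open>auto simp: \<sigma>_def avg_w\<close>)
    also note \<open>S \<le> ennreal A\<close>
    finally have *: "ennreal (m / b) * ennreal_powr \<sigma> (p - 1) \<le> ennreal A" .
    \<comment> \<open>The average of \<open>w\<close> is positive, so the finite product excludes
      \<infinity>; the value 0 is excluded because \<open>v\<close> is nowhere 0 on a ball of
      positive measure.\<close>
    have "\<sigma> \<noteq> \<infinity>"
      using * \<open>m > 0\<close> b assms by (auto simp: ennreal_powr_def ennreal_mult_top top_unique)
    moreover have "\<sigma> \<noteq> 0"
    proof
      assume "\<sigma> = 0"
      then have "(\<integral>\<^sup>+ y\<in>ball x r. v y \<partial>lebesgue) = 0"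
        using b by (auto simp: \<sigma>_def ball_average_def eb)
      then have "AE y in lebesgue. v y * indicator (ball x r) y = 0"
        by (subst (asm) nn_integral_0_iff_AE, measurable)
      then have "AE y in lebesgue. y \<notin> ball x r"
        by eventually_elim (auto simp: v0 indicator_def split: if_splits)
      then have "emeasure lebesgue (ball x r) = 0"
        by (subst (asm) AE_iff_measurable[of "ball x r"]) auto
      then show False using eb b by simp
    qed
    ultimately obtain s where s: "s > 0" "\<sigma> = ennreal s"
      by (cases \<sigma>) (auto simp: less_le)
    have "m / b * s powr (p - 1) \<le> A"
      using * s \<open>m > 0\<close> b A assms by (simp add: ennreal_powr_def flip: ennreal_mult)
    then have m_le: "m \<le> A * b * s powr (- (p - 1))"
      using b s unfolding powr_minus by (simp add: field_simps)
    have int_v: "(\<integral>\<^sup>+ y\<in>ball x r. v y \<partial>lebesgue) = ennreal (s * b)"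
    proof -
      have "(\<integral>\<^sup>+ y\<in>ball x r. v y \<partial>lebesgue) = \<sigma> * ennreal b"
        using b by (simp add: \<sigma>_def ball_average_def eb ennreal_divide_times mult_divide_eq_ennreal)
      then show ?thesis using s b by (simp add: ennreal_mult)
    qed
    \<comment> \<open>Chebyshev's inequality replaces Hoelder's: off \<open>N\<close>, which has at most half the measure of \<open>E\<close>,
      the weight is bounded below.\<close>
    define N where "N = {y \<in> ball x r. 1 \<le> ennreal (\<eta> / (2 * s)) * v y}"
    have [measurable]: "N \<in> sets lebesgue" unfolding N_def by measurable
    have "emeasure lebesgue N \<le> ennreal (\<eta> / (2 * s)) * (\<integral>\<^sup>+ y\<in>ball x r. v y \<partial>lebesgue)"
      unfolding N_def by (intro nn_integral_Markov_inequality) auto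
    also have "\<dots> = ennreal (\<eta> * b / 2)"
      using s assms b by (simp add: int_v flip: ennreal_mult)
    finally have N: "emeasure lebesgue N \<le> ennreal (\<eta> * b / 2)" .
    have "ennreal (\<eta> * b) \<le> emeasure lebesgue E" using big eb b assms by (simp add: ennreal_mult)
    also have "\<dots> \<le> emeasure lebesgue ((E - N) \<union> N)"
      by (intro emeasure_mono) auto
    also have "\<dots> \<le> emeasure lebesgue (E - N) + emeasure lebesgue N"
      by (intro emeasure_subadditive) auto
    also have "\<dots> \<le> emeasure lebesgue (E - N) + ennreal (\<eta> * b / 2)"
      using N by (intro add_left_mono)
    finally have "ennreal (\<eta> * b) - ennreal (\<eta> * b / 2) \<le> emeasure lebesgue (E - N)"
      by (subst ennreal_minus_le_iff) (auto simp: add.commute)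
    then have E': "ennreal (\<eta> * b / 2) \<le> emeasure lebesgue (E - N)"
      using assms b by (subst (asm) ennreal_minus) auto
    \<comment> \<open>Off \<open>N\<close> one has \<open>v y < 2 * s / \<eta>\<close>; raising this
      to the negative power \<open>-(p - 1)\<close> reverses it and turns \<open>v\<close> back into
      \<open>w\<close>.\<close>
    define \<tau> where "\<tau> = (2 * s / \<eta>) powr (- (p - 1))"
    have wlow: "\<tau> \<le> w y" if "y \<in> E - N" for y
    proof -
      have lt: "ennreal (\<eta> / (2 * s)) * v y < 1" using that sub by (auto simp: N_def not_le)
      then have wy: "w y > 0" using w0[of y] assms s
        by (auto simp: v less_le ennreal_mult_top top_unique)
      then have "\<eta> / (2 * s) * (w y powr - (1 / (p - 1))) < 1"
        using lt assms s by (simp add: v flip: ennreal_mult)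
      then have "w y powr - (1 / (p - 1)) < 2 * s / \<eta>"
        using assms s by (simp add: field_simps)
      then have "(2 * s / \<eta>) powr (- (p - 1)) \<le> (w y powr - (1 / (p - 1))) powr (- (p - 1))"
        using assms wy by (intro powr_mono2') auto
      also have "\<dots> = w y powr (- (1 / (p - 1)) * - (p - 1))" by (rule powr_powr)
      also have "- (1 / (p - 1)) * - (p - 1) = 1" using assms by (simp add: field_simps)
      also have "w y powr 1 = w y" using wy by simp
      finally show ?thesis unfolding \<tau>_def .
    qed
    have "c * m \<le> c * (A * b * s powr (- (p - 1)))" using m_le c by (intro mult_left_mono) auto
    also have "\<dots> = \<tau> * (\<eta> * b / 2)"
    proof -
      have "\<tau> = (2 / \<eta>) powr (- (p - 1)) * s powr (- (p - 1))"
        unfolding \<tau>_def using s assms by (subst powr_mult[symmetric]) auto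
      then show ?thesis using A by (simp add: c_def)
    qed
    finally have "ennreal (c * m) \<le> ennreal \<tau> * ennreal (\<eta> * b / 2)"
      using assms b by (simp add: \<tau>_def flip: ennreal_mult)
    also have "\<dots> \<le> ennreal \<tau> * emeasure lebesgue (E - N)"
      using E' by (intro mult_left_mono) auto
    also have "\<dots> = (\<integral>\<^sup>+ y. ennreal \<tau> * indicator (E - N) y \<partial>lebesgue)"
      by (rule nn_integral_cmult_indicator[symmetric]) measurable
    also have "\<dots> \<le> wmeas w E"
      unfolding wmeas_def using wlow by (intro nn_integral_mono) (auto simp: indicator_def ennreal_leI)
    finally show ?thesis using m c by (simp add: ennreal_mult)
  qed simp
  then show ?thesis using c by (intro exI[of _ c]) auto
qed

lemma muckenhoupt_wmeas_subset_ge: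
  fixes w :: "real ^ 'n \<Rightarrow> real"
  assumes "muckenhoupt p w" "0 < \<eta>"
  shows "\<exists>c>0. \<forall>x. \<forall>r>0. \<forall>E\<in>sets lebesgue. E \<subseteq> ball x r \<longrightarrow>
           ennreal \<eta> * emeasure lebesgue (ball x r) \<le> emeasure lebesgue E \<longrightarrow>
           ennreal c * wmeas w (ball x r) \<le> wmeas w E"
  using assms A_1_wmeas_subset_ge[of w \<eta>] A_p_wmeas_subset_ge[of _ w \<eta>]
  unfolding muckenhoupt_def A_infty_def by blast

lemma muckenhoupt_is_weight:
  "muckenhoupt p w \<Longrightarrow> is_weight w"
  unfolding muckenhoupt_def A_infty_def A_1_def A_p_def by blast

text \<open>A null ball fills a fixed proportion of each larger concentric ball, which would then be
  null too. Letting the radius grow would make \<open>w\<close> vanish almost everywhere.\<close>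

lemma wmeas_ball_pos:
  fixes w :: "real ^ 'n \<Rightarrow> real"
  assumes "muckenhoupt p w" "0 < r"
  shows "0 < wmeas w (ball x r)"
proof (rule ccontr)
  assume "\<not> 0 < wmeas w (ball x r)"
  then have z: "wmeas w (ball x r) = 0" by simp
  have wt: "is_weight w" by (rule muckenhoupt_is_weight[OF assms(1)])
  then have [measurable]: "w \<in> borel_measurable lebesgue" by (rule is_weight_measurable)
  have zero: "wmeas w (ball x (r + real i)) = 0" for i
  proof -
    define s where "s = r + real i"
    have s: "s > 0" "r \<le> s" using assms by (auto simp: s_def)
    \<comment> \<open>The exact volume ratio of the two concentric balls.\<close>
    define \<eta> where "\<eta> = (r / s) ^ CARD('n)"
    have \<eta>: "\<eta> > 0" using assms s by (simp add: \<eta>_def)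
    obtain c where c: "c > 0" "\<And>E. E \<in> sets lebesgue \<Longrightarrow> E \<subseteq> ball x s \<Longrightarrow>
           ennreal \<eta> * emeasure lebesgue (ball x s) \<le> emeasure lebesgue E \<Longrightarrow>
           ennreal c * wmeas w (ball x s) \<le> wmeas w E"
      using muckenhoupt_wmeas_subset_ge[OF assms(1) \<eta>] s by blast
    have "ennreal c * wmeas w (ball x s) \<le> wmeas w (ball x r)"
      using s assms \<eta>
      by (intro c) (auto simp: emeasure_ball \<eta>_def power_divide mult_ac simp flip: ennreal_mult)
    then show ?thesis using z c by (simp add: s_def)
  qed
  have "AE y in lebesgue. \<forall>i. ennreal (w y) * indicator (ball x (r + real i)) y = 0"
    unfolding AE_all_countable
  proof
    fix i show "AE y in lebesgue. ennreal (w y) * indicator (ball x (r + real i)) y = 0"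
      using zero[of i] unfolding wmeas_def by (subst (asm) nn_integral_0_iff_AE, measurable)
  qed
  then have "AE y in lebesgue. w y = 0"
  proof eventually_elim
    case (elim y)
    obtain i where "dist x y < real i" using reals_Archimedean2 by blast
    then have "y \<in> ball x (r + real i)" using assms by simp
    with elim[rule_format, of i] have "ennreal (w y) = 0" by simp
    then show ?case using wt by (auto simp: is_weight_def ennreal_eq_0_iff intro: antisym)
  qed
  then show False using wt by (simp add: is_weight_def)
qed

text \<open>The annulus between the two balls has at least half the volume of the larger one, hence
  at least a proportion \<open>c\<close> of its weight; the inner ball keeps at most
  \<open>1 - c\<close>.\<close>

lemma muckenhoupt_reverse_doubling:
  fixes w :: "real ^ 'n \<Rightarrow> real"
  assumes "muckenhoupt p w"
  shows "\<exists>q. 0 < q \<and> q < 1 \<and> (\<forall>x. \<forall>r>0. wmeas w (ball x r) \<le> ennreal q * wmeas w (ball x (2 * r)))"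
proof -
  have wt: "is_weight w" by (rule muckenhoupt_is_weight[OF assms(1)])
  then have [measurable]: "w \<in> borel_measurable lebesgue" by (rule is_weight_measurable)
  obtain c where c: "c > 0" "\<And>x r E. r > 0 \<Longrightarrow> E \<in> sets lebesgue \<Longrightarrow> E \<subseteq> ball x r \<Longrightarrow>
           ennreal (1 / 2) * emeasure lebesgue (ball x r) \<le> emeasure lebesgue E \<Longrightarrow>
           ennreal c * wmeas w (ball x r) \<le> wmeas w E"
    using muckenhoupt_wmeas_subset_ge[OF assms(1), of "1/2"] by auto
  \<comment> \<open>The maximum keeps \<open>q\<close> positive even if \<open>c\<close> is 1 or
    more.\<close>
  define q where "q = max (1 - c) (1 / 2)"
  have q: "0 < q" "q < 1" using c by (auto simp: q_def)
  have "wmeas w (ball x r) \<le> ennreal q * wmeas w (ball x (2 * r))" if r: "r > 0" for x r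
  proof -
    define E where "E = ball x (2 * r) - ball x r"
    have [measurable]: "E \<in> sets lebesgue" unfolding E_def by auto
    have sub: "ball x r \<subseteq> ball x (2 * r)" using r by (intro subset_ball) auto
    define V where "V = unit_ball_vol (CARD('n)) * r ^ CARD('n)"
    have V: "V > 0" using r by (simp add: V_def)
    have "emeasure lebesgue E = ennreal (2 ^ CARD('n) * V - V)"
      unfolding E_def using sub r V
      by (subst emeasure_Diff)
         (auto simp: emeasure_ball V_def power_mult_distrib mult_ac ennreal_minus)
    \<comment> \<open>The dimension is at least 1, so the inner ball has at most half the
      volume.\<close>
    moreover have "(2::real) ^ CARD('n) \<ge> 2 ^ 1" by (rule power_increasing) (auto simp: Suc_le_eq)
    then have "1 / 2 * (2 ^ CARD('n) * V) \<le> 2 ^ CARD('n) * V - V"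
      using V mult_right_mono[of 2 "2 ^ CARD('n)" V] by simp
    moreover have "emeasure lebesgue (ball x (2 * r)) = ennreal (2 ^ CARD('n) * V)"
      using r by (simp add: emeasure_ball V_def power_mult_distrib mult_ac)
    ultimately have "ennreal (1 / 2) * emeasure lebesgue (ball x (2 * r)) = ennreal (1 / 2 * (2 ^ CARD('n) * V))"
        and "ennreal (1 / 2 * (2 ^ CARD('n) * V)) \<le> emeasure lebesgue E"
      using V by (simp_all only: ennreal_mult[symmetric] ennreal_leI)
    then have "ennreal (1 / 2) * emeasure lebesgue (ball x (2 * r)) \<le> emeasure lebesgue E"
      by order
    then have 1: "ennreal c * wmeas w (ball x (2 * r)) \<le> wmeas w E"
      using r by (intro c) (auto simp: E_def)
    have "wmeas w (ball x (2 * r)) =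
        (\<integral>\<^sup>+ y. ennreal (w y) * indicator (ball x r) y + ennreal (w y) * indicator E y \<partial>lebesgue)"
      unfolding wmeas_def using sub by (intro nn_integral_cong) (auto simp: indicator_def E_def)
    also have "\<dots> = wmeas w (ball x r) + wmeas w E"
      unfolding wmeas_def by (rule nn_integral_add) measurable
    finally have 2: "wmeas w (ball x (2 * r)) = wmeas w (ball x r) + wmeas w E" .
    obtain a where a: "a \<ge> 0" "wmeas w (ball x (2 * r)) = ennreal a"
      using wmeas_ball_finite[OF wt, of x "2 * r"] by (cases "wmeas w (ball x (2 * r))") auto
    obtain a' where a': "a' \<ge> 0" "wmeas w (ball x r) = ennreal a'"
      using wmeas_ball_finite[OF wt, of x r] by (cases "wmeas w (ball x r)") auto
    obtain e where e: "e \<ge> 0" "wmeas w E = ennreal e"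
      using 2 a by (cases "wmeas w E") auto
    have "c * a \<le> e" using 1 a e c by (simp flip: ennreal_mult)
    moreover have "a = a' + e" using 2 a a' e by (simp flip: ennreal_plus)
    ultimately have "a' \<le> (1 - c) * a" by (simp add: algebra_simps)
    also have "\<dots> \<le> q * a" using a by (intro mult_right_mono) (auto simp: q_def)
    finally show ?thesis using a a' q by (simp flip: ennreal_mult)
  qed
  then show ?thesis using q by auto
qed

lemma wmeas_ball_iterate:
  fixes w :: "real ^ 'n \<Rightarrow> real"
  assumes "\<And>x r. r > 0 \<Longrightarrow> wmeas w (ball x r) \<le> ennreal q * wmeas w (ball x (2 * r))" "0 < q" "r > 0"
  shows "wmeas w (ball x r) \<le> ennreal (q ^ k) * wmeas w (ball x (2 ^ k * r))"
proof (induction k)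
  case (Suc k)
  have "ennreal (q ^ k) * wmeas w (ball x (2 ^ k * r)) \<le> ennreal (q ^ k) * (ennreal q * wmeas w (ball x (2 * (2 ^ k * r))))"
    using assms by (intro mult_left_mono) auto
  also have "\<dots> = ennreal (q ^ Suc k) * wmeas w (ball x (2 ^ Suc k * r))"
    using assms by (simp add: mult_ac ennreal_mult)
  finally show ?case using Suc by order
qed simp

section \<open>Norm estimates\<close>

lemma ennreal_le_suminf: "f j \<le> (\<Sum>i. f i :: ennreal)"
  using sum_le_suminf[OF summableI, of "{j}" f] by simp

lemma wmeas_ball_mult_inverse:
  fixes w :: "real ^ 'n \<Rightarrow> real"
  assumes "muckenhoupt p w" "0 < r"
  shows "wmeas w (ball x r) * inverse (wmeas w (ball x r)) = 1"
  using ennreal_divide_self[of "wmeas w (ball x r)"] wmeas_ball_pos[OF assms, of x]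
    wmeas_ball_finite[OF muckenhoupt_is_weight[OF assms(1)], of x r]
  by (simp add: divide_ennreal_def)

text \<open>Balls have positive finite weight, and the limits of \<open>\<Phi>\<close> at 0 and at
  infinity keep the inverse away from 0 and \<infinity>. The later estimates can thus be made with a
  real number \<open>P\<close>.\<close>

lemma young_inv_ball:
  fixes w :: "real ^ 'n \<Rightarrow> real"
  assumes "young_function \<Phi>" "muckenhoupt p w" "0 < r"
  obtains P where "0 < P" "young_inv \<Phi> (inverse (wmeas w (ball x r))) = ennreal P"
proof -
  have "0 < wmeas w (ball x r)" "wmeas w (ball x r) < \<infinity>"
    using wmeas_ball_pos[OF assms(2,3)] wmeas_ball_finite[OF muckenhoupt_is_weight[OF assms(2)]] by auto
  then have "0 < inverse (wmeas w (ball x r))" "inverse (wmeas w (ball x r)) < \<infinity>"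
    by (auto simp: ennreal_inverse_positive less_top[symmetric])
  from young_inv_pos[OF assms(1) this(1)] young_inv_finite[OF assms(1) this(2)]
  show thesis
    by (intro that[of "enn2real (young_inv \<Phi> (inverse (wmeas w (ball x r))))"])
       (auto simp: enn2real_positive_iff)
qed

text \<open>Convexity moves a factor \<open>\<kappa>\<close> from the argument to the front.
  Enlarging the norm constant therefore makes the modular small without any doubling of
  \<open>\<Phi>\<close>.\<close>

lemma young_le_scaled_inv:
  assumes Y: "young_function \<Phi>" and "0 \<le> a" "a \<le> \<kappa> * P" "0 \<le> \<kappa>" "\<kappa> \<le> 1" "0 \<le> P"
    and "ennreal P \<le> young_inv \<Phi> t"
  shows "\<Phi> a \<le> ennreal \<kappa> * t"
proof -
  have "\<Phi> a \<le> \<Phi> (\<kappa> * P)" using assms by (intro young_mono[OF Y])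
  also have "\<dots> \<le> ennreal \<kappa> * \<Phi> P" using assms by (intro young_scale[OF Y])
  also have "\<dots> \<le> ennreal \<kappa> * t" using assms by (intro mult_left_mono young_le_of_le_inv[OF Y]) auto
  finally show ?thesis .
qed

text \<open>Uniform upper bound for the test functions. A ball of radius \<open>s\<close> is
  compared with each radius \<open>4^(j+1) * R\<close>: one half of the class condition serves the
  larger radii, the other half the smaller ones. The latter contribute a series that converges by
  reverse doubling.\<close>

lemma morrey_norm_lacunary:
  fixes w :: "real ^ 'n \<Rightarrow> real"
  assumes Y: "young_function \<Phi>" and Mu: "muckenhoupt p w" and G: "\<phi> \<in> class_G \<Phi> w"
  obtains \<Lambda> where "\<Lambda> > 0" "\<And>R Q x (f :: real ^ 'n \<Rightarrow> 'k::{real_normed_field, euclidean_space}).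
    R > 0 \<Longrightarrow> (\<And>j. Q j \<in> sets lebesgue) \<Longrightarrow> (\<And>j. Q j \<subseteq> ball x (2 ^ (j + 2) * R)) \<Longrightarrow>
    f \<in> borel_measurable lebesgue \<Longrightarrow>
    (\<And>y. f y \<noteq> 0 \<Longrightarrow> \<exists>j. y \<in> Q j \<and> norm (f y) \<le> \<phi> x (4 ^ (j + 1) * R)) \<Longrightarrow>
    f \<in> morrey_space \<Phi> \<phi> w \<and> morrey_norm \<Phi> \<phi> w f \<le> ennreal \<Lambda>"
proof -
  have wt: "is_weight w" by (rule muckenhoupt_is_weight[OF Mu])
  have [measurable]: "w \<in> borel_measurable lebesgue" by (rule is_weight_measurable[OF wt])
  obtain q where q: "0 < q" "q < 1"
    "\<And>x r. r > 0 \<Longrightarrow> wmeas w (ball x r) \<le> ennreal q * wmeas w (ball x (2 * r))"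
    using muckenhoupt_reverse_doubling[OF Mu] by auto
  obtain C where C: "C > 0" and pos: "\<And>x r. r > 0 \<Longrightarrow> 0 < \<phi> x r"
    and G1: "\<And>x x0 r r0. r > 0 \<Longrightarrow> r \<le> r0 \<Longrightarrow> \<phi> x0 r0 \<le> C * \<phi> x r"
    and G2: "\<And>x x0 r r0. r0 > 0 \<Longrightarrow> r0 \<le> r \<Longrightarrow>
       ennreal (\<phi> x0 r0) / young_inv \<Phi> (inverse (wmeas w (ball x0 r0)))
             \<le> ennreal C * (ennreal (\<phi> x r) / young_inv \<Phi> (inverse (wmeas w (ball x r))))"
    using G unfolding class_G_def by fastforce
  \<comment> \<open>The modular is at most \<open>\<kappa>\<close> times one term for the tested
    ball plus the geometric series of \<open>q\<close>. These total \<open>X\<close>, so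
    \<open>\<kappa> = 1 / X\<close> brings the modular down to 1.\<close>
  define X where "X = 1 + 1 / (1 - q)"
  have X: "1 \<le> X" using q by (simp add: X_def)
  define \<Lambda> where "\<Lambda> = C * X"
  define \<kappa> where "\<kappa> = 1 / X"
  have \<Lambda>: "\<Lambda> > 0" and \<kappa>: "0 \<le> \<kappa>" "\<kappa> \<le> 1" "\<kappa> * X = 1" and \<kappa>_\<Lambda>: "\<kappa> = C / \<Lambda>"
    using C X by (auto simp: \<Lambda>_def \<kappa>_def)
  have "f \<in> morrey_space \<Phi> \<phi> w \<and> morrey_norm \<Phi> \<phi> w f \<le> ennreal \<Lambda>"
    if R: "R > 0" and Q: "\<And>j. Q j \<in> sets lebesgue" "\<And>j. Q j \<subseteq> ball x (2 ^ (j + 2) * R)"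
      and f: "f \<in> borel_measurable lebesgue"
      and supp: "\<And>y. f y \<noteq> 0 \<Longrightarrow> \<exists>j. y \<in> Q j \<and> norm (f y) \<le> \<phi> x (4 ^ (j + 1) * R)"
    for x R Q and f :: "real ^ 'n \<Rightarrow> 'k"
  proof -
    define W where "W j = wmeas w (ball x (4 ^ (j + 1) * R))" for j
    note [measurable] = Q(1) f
    \<comment> \<open>The ball around \<open>Q j\<close> becomes the ball of weight
      \<open>W j\<close> after \<open>j\<close> doublings, each gaining a factor
      \<open>q\<close>.\<close>
    have WQ: "inverse (W j) * wmeas w (Q j) \<le> ennreal (q ^ j)" for j
    proof -
      have "wmeas w (Q j) \<le> wmeas w (ball x (2 ^ (j + 2) * R))" by (intro wmeas_mono Q)
      also have "\<dots> \<le> ennreal (q ^ j) * wmeas w (ball x (2 ^ j * (2 ^ (j + 2) * R)))"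
        using q R by (intro wmeas_ball_iterate) auto
      also have "2 ^ j * (2 ^ (j + 2) * R) = 4 ^ (j + 1) * R"
        by (simp add: power_mult_distrib[symmetric])
      finally have "inverse (W j) * wmeas w (Q j) \<le> inverse (W j) * (ennreal (q ^ j) * W j)"
        unfolding W_def by (intro mult_left_mono) auto
      also have "\<dots> = ennreal (q ^ j) * (W j * inverse (W j))" by (simp add: mult_ac)
      also have "W j * inverse (W j) = 1"
        unfolding W_def using R by (intro wmeas_ball_mult_inverse[OF Mu]) simp
      finally show ?thesis by simp
    qed
    have bound: "\<exists>P>0. young_inv \<Phi> (inverse (wmeas w (ball z s))) = ennreal P \<and>
        orlicz_norm \<Phi> w (restr (ball z s) f) \<le> ennreal (\<Lambda> * \<phi> z s / P)" if s: "s > 0" for z s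
    proof -
      obtain P where P: "0 < P" "young_inv \<Phi> (inverse (wmeas w (ball z s))) = ennreal P"
        using young_inv_ball[OF Y Mu s] by blast
      define l where "l = \<Lambda> * \<phi> z s / P"
      have l: "l > 0" using P \<Lambda> pos[OF s] by (simp add: l_def)
      define m where "m = wmeas w (ball z s)"
      have m: "m * inverse m = 1"
        unfolding m_def by (rule wmeas_ball_mult_inverse[OF Mu s])
      have \<Phi>0: "\<Phi> 0 = 0" using Y by (simp add: young_function_def)
      \<comment> \<open>The first term takes care of the points of those \<open>Q j\<close> with
        \<open>s\<close> at most \<open>4^(j+1) * R\<close>, the series of the others.\<close>
      have pt: "\<Phi> (norm (restr (ball z s) f y) / l) * ennreal (w y) \<le>
          ennreal \<kappa> * inverse m * (ennreal (w y) * indicator (ball z s) y) +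
          (\<Sum>j. ennreal \<kappa> * inverse (W j) * (ennreal (w y) * indicator (Q j) y))" for y
      proof (cases "y \<in> ball z s \<and> f y \<noteq> 0")
        case False
        then have "restr (ball z s) f y = 0" by (auto simp: restr_def)
        then show ?thesis by (simp add: \<Phi>0)
      next
        case True
        then obtain j where j: "y \<in> Q j" "norm (f y) \<le> \<phi> x (4 ^ (j + 1) * R)" using supp by blast
        have re: "norm (restr (ball z s) f y) = norm (f y)" using True by (simp add: restr_def)
        have \<rho>: "4 ^ (j + 1) * R > 0" using R by simp
        show ?thesis
        \<comment> \<open>For small \<open>s\<close> the values of \<open>\<phi>\<close> are
          compared directly, and dividing by \<open>l\<close> leaves \<open>\<kappa>\<close> times
          \<open>P\<close>. For large \<open>s\<close> the quotients by the inverse Young function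
          are compared, which leaves \<open>\<kappa>\<close> times \<open>P'\<close>.\<close>
        proof (cases "s \<le> 4 ^ (j + 1) * R")
          case le: True
          have "norm (f y) / l \<le> C * \<phi> z s / l"
            using j G1[OF s le, of x z] l by (intro divide_right_mono) auto
          also have "\<dots> = \<kappa> * P"
            using P \<Lambda> pos[OF s, of z] by (simp add: l_def \<kappa>_\<Lambda>)
          finally have "\<Phi> (norm (f y) / l) \<le> ennreal \<kappa> * inverse m"
            using l \<kappa> P by (intro young_le_scaled_inv[OF Y, where P = P]) (auto simp: m_def)
          then have "\<Phi> (norm (f y) / l) * ennreal (w y) \<le> ennreal \<kappa> * inverse m * ennreal (w y)"
            by (intro mult_right_mono) auto
          then show ?thesis using True re by (auto intro: add_increasing2)
        next
          case gt: False
          obtain P' where P': "0 < P'" "young_inv \<Phi> (inverse (W j)) = ennreal P'"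
            using young_inv_ball[OF Y Mu \<rho>] unfolding W_def by blast
          have "ennreal (\<phi> x (4 ^ (j + 1) * R)) / ennreal P' \<le> ennreal C * (ennreal (\<phi> z s) / ennreal P)"
            using G2[OF \<rho>, of s x z] gt P P' unfolding W_def by simp
          then have "\<phi> x (4 ^ (j + 1) * R) / P' \<le> C * (\<phi> z s / P)"
            using P P' C pos[OF \<rho>, of x] pos[OF s, of z]
            by (simp add: divide_ennreal less_imp_le flip: ennreal_mult)
          then have "\<phi> x (4 ^ (j + 1) * R) / l \<le> C * (\<phi> z s / P) * P' / l"
            using P' l by (intro divide_right_mono) (auto simp: field_simps)
          also have "\<dots> = \<kappa> * P'"
            using P \<Lambda> pos[OF s, of z] by (simp add: l_def \<kappa>_\<Lambda>)
          finally have "norm (f y) / l \<le> \<kappa> * P'"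
            using j l by (meson divide_right_mono less_imp_le order_trans)
          then have "\<Phi> (norm (f y) / l) \<le> ennreal \<kappa> * inverse (W j)"
            using l \<kappa> P' by (intro young_le_scaled_inv[OF Y, where P = P']) auto
          then have "\<Phi> (norm (f y) / l) * ennreal (w y) \<le>
              ennreal \<kappa> * inverse (W j) * (ennreal (w y) * indicator (Q j) y)"
            using j by (auto intro: mult_right_mono)
          also have "\<dots> \<le> (\<Sum>i. ennreal \<kappa> * inverse (W i) * (ennreal (w y) * indicator (Q i) y))"
            by (rule ennreal_le_suminf)
          finally show ?thesis using re by (auto intro: add_increasing)
        qed
      qed
      have "(\<integral>\<^sup>+ y. \<Phi> (norm (restr (ball z s) f y) / l) * ennreal (w y) \<partial>lebesgue) \<le>
        (\<integral>\<^sup>+ y. ennreal \<kappa> * inverse m * (ennreal (w y) * indicator (ball z s) y) +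
          (\<Sum>j. ennreal \<kappa> * inverse (W j) * (ennreal (w y) * indicator (Q j) y)) \<partial>lebesgue)"
        by (intro nn_integral_mono pt)
      also have "\<dots> = ennreal \<kappa> * inverse m * m + (\<Sum>j. ennreal \<kappa> * inverse (W j) * wmeas w (Q j))"
        unfolding m_def wmeas_def
        by (simp add: nn_integral_add nn_integral_suminf nn_integral_cmult)
      also have "\<dots> \<le> ennreal \<kappa> + (\<Sum>j. ennreal \<kappa> * ennreal (q ^ j))"
      proof (intro add_mono suminf_le)
        show "ennreal \<kappa> * inverse m * m \<le> ennreal \<kappa>"
          using m by (simp add: mult.assoc mult.commute[of m])
        show "ennreal \<kappa> * inverse (W j) * wmeas w (Q j) \<le> ennreal \<kappa> * ennreal (q ^ j)" for j
          using WQ[of j] by (simp add: mult.assoc mult_left_mono)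
      qed auto
      also have "(\<Sum>j. ennreal \<kappa> * ennreal (q ^ j)) = ennreal (\<kappa> * (1 / (1 - q)))"
      proof -
        have "(\<lambda>j. \<kappa> * q ^ j) sums (\<kappa> * (1 / (1 - q)))"
          using q by (intro sums_mult geometric_sums) auto
        then have "(\<Sum>j. ennreal (\<kappa> * q ^ j)) = ennreal (\<kappa> * (1 / (1 - q)))"
          using \<kappa> q by (intro suminf_ennreal_eq) auto
        then show ?thesis using \<kappa> q by (simp add: ennreal_mult)
      qed
      also have "ennreal \<kappa> + ennreal (\<kappa> * (1 / (1 - q))) = 1"
        using \<kappa> q by (simp add: X_def algebra_simps flip: ennreal_plus)
      finally have "orlicz_norm \<Phi> w (restr (ball z s) f) \<le> ennreal l"
        unfolding orlicz_norm_def using l by (intro INF_lower) auto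
      then show ?thesis using P unfolding l_def by blast
    qed
    have "orlicz_norm \<Phi> w (restr (ball z s) f) < \<infinity>" if "s > 0" for z s
    proof -
      obtain P where "orlicz_norm \<Phi> w (restr (ball z s) f) \<le> ennreal (\<Lambda> * \<phi> z s / P)"
        using bound[OF \<open>s > 0\<close>] by blast
      also have "\<dots> < \<infinity>" by simp
      finally show ?thesis .
    qed
    then have "f \<in> orlicz_loc \<Phi> w" using f by (simp add: orlicz_loc_def)
    moreover have "morrey_norm \<Phi> \<phi> w f \<le> ennreal \<Lambda>"
      unfolding morrey_norm_def
    proof (rule SUP_least)
      fix u :: "(real ^ 'n) \<times> real" assume "u \<in> UNIV \<times> {0<..}"
      then obtain z s where u: "u = (z, s)" and s: "s > 0" by auto
      obtain P where P: "P > 0" "young_inv \<Phi> (inverse (wmeas w (ball z s))) = ennreal P"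
        "orlicz_norm \<Phi> w (restr (ball z s) f) \<le> ennreal (\<Lambda> * \<phi> z s / P)" using bound[OF s] by blast
      have "ennreal (inverse (\<phi> z s)) * young_inv \<Phi> (inverse (wmeas w (ball z s))) *
         orlicz_norm \<Phi> w (restr (ball z s) f) \<le>
         ennreal (inverse (\<phi> z s)) * ennreal P * ennreal (\<Lambda> * \<phi> z s / P)"
        unfolding P(2) using P(3) by (intro mult_left_mono) auto
      also have "\<dots> = ennreal \<Lambda>"
        using P(1) \<Lambda> pos[OF s, of z] by (simp add: field_simps flip: ennreal_mult)
      finally show "(case u of (z, s) \<Rightarrow> ennreal (inverse (\<phi> z s)) *
         young_inv \<Phi> (inverse (wmeas w (ball z s))) * orlicz_norm \<Phi> w (restr (ball z s) f)) \<le> ennreal \<Lambda>"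
        unfolding u by simp
    qed
    moreover from this have "morrey_norm \<Phi> \<phi> w f < \<infinity>"
      by (rule le_less_trans) simp
    ultimately show ?thesis by (simp add: morrey_space_def)
  qed
  from \<Lambda> this show thesis by (rule that)
qed

text \<open>The first factor is the reciprocal of the Orlicz norm of the indicator of the ball: if
  \<open>l\<close> is admissible, then \<open>\<Phi> (c / l)\<close> times the weight of the ball is
  at most 1, so \<open>c / l\<close> is at most that factor.\<close>

lemma young_inv_mult_orlicz_norm_ge:
  fixes w :: "real ^ 'n \<Rightarrow> real" and F :: "real ^ 'n \<Rightarrow> 'k::{real_normed_field, euclidean_space}"
  assumes Y: "young_function \<Phi>" and Mu: "muckenhoupt p w" and r: "0 < r" and c: "0 \<le> c"
    and F: "AE y in lebesgue. y \<in> ball x r \<longrightarrow> c \<le> norm (F y)"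
  shows "ennreal c \<le> young_inv \<Phi> (inverse (wmeas w (ball x r))) * orlicz_norm \<Phi> w (restr (ball x r) F)"
proof -
  have wt: "is_weight w" by (rule muckenhoupt_is_weight[OF Mu])
  have [measurable]: "w \<in> borel_measurable lebesgue" by (rule is_weight_measurable[OF wt])
  obtain P where P: "0 < P" "young_inv \<Phi> (inverse (wmeas w (ball x r))) = ennreal P"
    using young_inv_ball[OF Y Mu r] by blast
  define m where "m = wmeas w (ball x r)"
  have m: "m * inverse m = 1" unfolding m_def by (rule wmeas_ball_mult_inverse[OF Mu r])
  have "ennreal (c / P) \<le> orlicz_norm \<Phi> w (restr (ball x r) F)"
    unfolding orlicz_norm_def
  proof (rule INF_greatest, clarify)
    fix l :: real
    assume l: "0 < l" and int: "(\<integral>\<^sup>+ y. \<Phi> (norm (restr (ball x r) F y) / l) * ennreal (w y) \<partial>lebesgue) \<le> 1"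
    have "\<Phi> (c / l) * m = (\<integral>\<^sup>+ y. \<Phi> (c / l) * (ennreal (w y) * indicator (ball x r) y) \<partial>lebesgue)"
      unfolding m_def wmeas_def by (rule nn_integral_cmult[symmetric]) measurable
    also have "\<dots> \<le> (\<integral>\<^sup>+ y. \<Phi> (norm (restr (ball x r) F y) / l) * ennreal (w y) \<partial>lebesgue)"
    proof (rule nn_integral_mono_AE)
      show "AE y in lebesgue. \<Phi> (c / l) * (ennreal (w y) * indicator (ball x r) y)
          \<le> \<Phi> (norm (restr (ball x r) F y) / l) * ennreal (w y)"
        using F
      proof eventually_elim
        case (elim y)
        show ?case
        proof (cases "y \<in> ball x r")
          case True
          then have "\<Phi> (c / l) \<le> \<Phi> (norm (F y) / l)"
            using elim c l by (intro young_mono[OF Y]) (auto intro: divide_right_mono)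
          with True show ?thesis by (auto simp: restr_def intro: mult_right_mono)
        qed simp
      qed
    qed
    also note int
    finally have "\<Phi> (c / l) * m \<le> 1" .
    then have "\<Phi> (c / l) * m * inverse m \<le> 1 * inverse m" by (intro mult_right_mono) auto
    then have "\<Phi> (c / l) \<le> inverse m"
      using m by (simp add: mult.assoc)
    then have "ennreal (c / l) \<le> ennreal P"
      using young_inv_geI[OF Y, of "c / l" "inverse m"] c l P(2) by (simp add: m_def)
    then have "c / l \<le> P" using P by simp
    then show "ennreal (c / P) \<le> ennreal l" using l P by (intro ennreal_leI) (simp add: field_simps)
  qed
  then have "ennreal P * ennreal (c / P) \<le> ennreal P * orlicz_norm \<Phi> w (restr (ball x r) F)"
    by (intro mult_left_mono) auto
  then show ?thesis using P c by (simp flip: ennreal_mult)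
qed

section \<open>Lower bounds for singular integrals\<close>

text \<open>The constant sequence 0 is an admissible approximation, so \<open>T 0 - h\<close> has
  weak norm 0, while the \<open>L2\<close> bound gives \<open>T 0 = 0\<close> almost everywhere.
  This disposes of the local part of \<open>T f\<close> where \<open>f\<close> vanishes on the
  doubled ball.\<close>

lemma weak_ext_zero:
  fixes T :: "(real ^ 'n \<Rightarrow> 'k::{real_normed_field, euclidean_space}) \<Rightarrow> (real ^ 'n \<Rightarrow> 'k)"
  assumes T: "bounded_linear_L2 T" and h: "weak_ext T (\<lambda>_. 0) h"
  shows "AE x in lebesgue. h x = 0"
proof -
  let ?z = "\<lambda>_ :: real ^ 'n. 0 :: 'k"
  have [measurable]: "h \<in> borel_measurable lebesgue" using h by (simp add: weak_ext_def)
  have "?z \<in> L2" by (simp add: L2_def)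
  with T have Tz: "T ?z \<in> L2" and
    "\<exists>C\<ge>0. (\<integral>\<^sup>+ x. ennreal ((norm (T ?z x))\<^sup>2) \<partial>lebesgue)
        \<le> ennreal (C\<^sup>2) * (\<integral>\<^sup>+ x. ennreal ((norm (?z x))\<^sup>2) \<partial>lebesgue)"
    unfolding bounded_linear_L2_def by blast+
  then have int0: "(\<integral>\<^sup>+ x. ennreal ((norm (T ?z x))\<^sup>2) \<partial>lebesgue) = 0" by simp
  from Tz have [measurable]: "T ?z \<in> borel_measurable lebesgue" by (simp add: L2_def)
  have "(\<lambda>x. ennreal ((norm (T ?z x))\<^sup>2)) \<in> borel_measurable lebesgue" by measurable
  from int0[unfolded nn_integral_0_iff_AE[OF this]] have T0: "AE x in lebesgue. T ?z x = 0" by simp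
  have "?z \<in> bounded_cpt" by (simp add: bounded_cpt_def fsupp_def)
  then have "(\<lambda>m::nat. weak_L1_norm (\<lambda>x. T ?z x - h x)) \<longlonglongrightarrow> 0"
    using h unfolding weak_ext_def by (elim conjE allE[of _ "\<lambda>_. ?z"]) auto
  then have "weak_L1_norm (\<lambda>x. T ?z x - h x) = 0" by (simp add: LIMSEQ_const_iff)
  then have null: "ennreal t * emeasure lebesgue {x. t < norm (T ?z x - h x)} = 0" if "t > 0" for t
    unfolding weak_L1_norm_def using that
    by (metis (no_types, lifting) SUP_upper greaterThan_iff le_zero_eq)
  \<comment> \<open>Countably many thresholds suffice: a nonzero value exceeds one of them in
    norm.\<close>
  have "AE x in lebesgue. \<forall>k. \<not> 1 / real (Suc k) < norm (T ?z x - h x)"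
    unfolding AE_all_countable
  proof
    fix k
    have "emeasure lebesgue {x. 1 / real (Suc k) < norm (T ?z x - h x)} = 0"
      using null[of "1 / real (Suc k)"] by simp
    moreover have "{x \<in> space lebesgue. 1 / real (Suc k) < norm (T ?z x - h x)} \<in> sets lebesgue"
      by measurable
    ultimately show "AE x in lebesgue. \<not> 1 / real (Suc k) < norm (T ?z x - h x)"
      by (subst AE_iff_measurable[of "{x. 1 / real (Suc k) < norm (T ?z x - h x)}"]) auto
  qed
  with T0 show ?thesis
  proof eventually_elim
    case (elim x)
    show ?case
    proof (rule ccontr)
      assume "h x \<noteq> 0"
      then obtain k where "inverse (real (Suc k)) < norm (h x)"
        using reals_Archimedean[of "norm (h x)"] by auto
      with elim show False by (auto simp: inverse_eq_divide)
    qed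
  qed
qed

text \<open>Only the kernel integral remains, since the local part is the extension of
  \<open>T\<close> at 0. Its integrand is real and nonnegative, so nothing cancels and the norm may
  be taken inside.\<close>

lemma cz_image_eq_nn_integral:
  fixes T :: "(real ^ 'n \<Rightarrow> 'k::{real_normed_field, euclidean_space}) \<Rightarrow> (real ^ 'n \<Rightarrow> 'k)"
  assumes T: "bounded_linear_L2 T" and r: "r > 0" and g: "\<And>y. 0 \<le> g y"
    and F: "cz_image T K (\<lambda>y. of_real (g y)) F"
    and vanish: "\<And>y. y \<in> ball x0 (2 * r) \<Longrightarrow> g y = 0"
    and K: "\<And>x y. x \<in> ball x0 r \<Longrightarrow> g y \<noteq> 0 \<Longrightarrow> \<exists>a\<ge>0. K x y = of_real a"
  shows "AE x in lebesgue. x \<in> ball x0 r \<longrightarrow>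
           ennreal (norm (F x)) = (\<integral>\<^sup>+ y. ennreal (norm (K x y) * g y) \<partial>lebesgue)"
proof -
  have eq0: "restr (ball x0 (2 * r)) (\<lambda>y. of_real (g y) :: 'k) = (\<lambda>_. 0)"
    using vanish by (auto simp: restr_def indicator_def fun_eq_iff)
  obtain h where h: "weak_ext T (\<lambda>_. 0) h"
    "AE x in lebesgue. x \<in> ball x0 r \<longrightarrow>
           set_integrable lebesgue (- ball x0 (2 * r)) (\<lambda>y. K x y * of_real (g y)) \<and>
           F x = h x + (LINT y:- ball x0 (2 * r)|lebesgue. K x y * of_real (g y))"
    using F[unfolded cz_image_def, rule_format, OF r, of x0] unfolding eq0 by (elim exE conjE)
  from h(2) weak_ext_zero[OF T h(1)] show ?thesis
  proof eventually_elim
    case (elim x)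
    show ?case
    proof
      assume x: "x \<in> ball x0 r"
      \<comment> \<open>Where \<open>g\<close> is nonzero, the kernel equals its own norm and
        \<open>y\<close> lies outside the doubled ball; elsewhere both sides are 0.\<close>
      have eq: "indicator (- ball x0 (2 * r)) y *\<^sub>R (K x y * of_real (g y)) =
          (of_real (norm (K x y) * g y) :: 'k)" for y
      proof (cases "g y = 0")
        case False
        then obtain a where "a \<ge> 0" "K x y = of_real a" using K[OF x] by blast
        then show ?thesis using False vanish[of y] by (auto simp: indicator_def)
      qed simp
      from elim x have int: "integrable lebesgue (\<lambda>y. of_real (norm (K x y) * g y) :: 'k)"
        and Fx: "F x = (LINT y|lebesgue. of_real (norm (K x y) * g y))"
        unfolding set_integrable_def set_lebesgue_integral_def eq by auto
      have intr: "integrable lebesgue (\<lambda>y. norm (K x y) * g y)"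
        using integrable_norm[OF int] g by (simp add: norm_mult)
      have "F x = of_real (LINT y|lebesgue. norm (K x y) * g y)"
        unfolding Fx by (rule integral_of_real[OF intr])
      then have "norm (F x) = (LINT y|lebesgue. norm (K x y) * g y)"
        using g by (simp add: integral_nonneg_AE)
      then show "ennreal (norm (F x)) = (\<integral>\<^sup>+ y. ennreal (norm (K x y) * g y) \<partial>lebesgue)"
        using nn_integral_eq_integral[OF intr] g by simp
    qed
  qed
qed

section \<open>Directions in which the kernel is positive\<close>

lemma open_cone:
  fixes R :: "real ^ 'n ^ 'n"
  assumes R: "orthogonal_matrix R"
  shows "open (cone k \<theta> R)"
proof -
  have "continuous_on UNIV (\<lambda>v :: real ^ 'n. if i = k then 0 else v $ i)" for i
    by (cases "i = k") (auto intro: continuous_intros)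
  then have cont: "continuous_on UNIV (\<lambda>v :: real ^ 'n. \<chi> i. if i = k then 0 else v $ i)"
    by (rule continuous_on_vec_lambda)
  have "open {v :: real ^ 'n. norm (\<chi> i. if i = k then 0 else v $ i) < \<theta> * \<bar>v $ k\<bar>}"
    by (rule open_Collect_less[OF continuous_on_norm[OF cont]]) (intro continuous_intros)
  moreover have "surj ((*v) R)"
    using R by (metis matrix_right_invertible_surjective orthogonal_matrix_def)
  ultimately show ?thesis
    unfolding cone_def by (intro open_surjective_linear_image) auto
qed

lemma cone_scaleR:
  assumes "v \<in> cone k \<theta> R" "s > 0"
  shows "s *\<^sub>R v \<in> cone k \<theta> R"
proof -
  obtain u where u: "v = R *v u" "norm (\<chi> i. if i = k then 0 else u $ i) < \<theta> * \<bar>u $ k\<bar>"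
    using assms by (auto simp: cone_def)
  have "(\<chi> i. if i = k then 0 else (s *\<^sub>R u) $ i) = s *\<^sub>R (\<chi> i. if i = k then 0 else u $ i)"
    by (simp add: vec_eq_iff)
  then have "norm (\<chi> i. if i = k then 0 else (s *\<^sub>R u) $ i) < \<theta> * \<bar>(s *\<^sub>R u) $ k\<bar>"
    using mult_strict_left_mono[OF u(2) assms(2)] assms(2) by (simp add: abs_mult mult_ac)
  moreover have "s *\<^sub>R v = R *v (s *\<^sub>R u)"
    unfolding u(1) by (simp add: matrix_vector_mult_scaleR)
  ultimately show ?thesis unfolding cone_def by blast
qed

text \<open>The cone is open and invariant under dilations, so a neighbourhood of its unit axis
  vector \<open>e\<close> works at every scale \<open>s\<close>. The width
  \<open>2 * \<kappa>\<close> leaves room for two displacements below \<open>\<kappa>\<close>: one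
  of the evaluation point, one inside a test ball.\<close>

lemma genuine_kernel_direction:
  fixes K :: "real ^ 'n \<Rightarrow> real ^ 'n \<Rightarrow> 'k::real_normed_field"
  assumes "genuine_kernel K"
  obtains c e \<kappa> where "c > 0" "norm e = 1" "0 < \<kappa>" "\<kappa> \<le> 1 / 4"
    "\<And>x y s d. s > 0 \<Longrightarrow> norm d < 2 * \<kappa> \<Longrightarrow> x - y = s *\<^sub>R (e + d) \<Longrightarrow>
       \<exists>a. K x y = of_real a \<and> c / norm (x - y) ^ CARD('n) \<le> a"
proof -
  obtain c \<theta> R k where c: "c > 0" "\<theta> > 0" "orthogonal_matrix R"
    and K: "\<And>x y. x - y \<in> cone k \<theta> R \<Longrightarrow> \<exists>a. K x y = of_real a \<and> c / norm (x - y) ^ CARD('n) \<le> a"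
    using assms unfolding genuine_kernel_def by blast
  define e where "e = R *v axis k 1"
  have "orthogonal_transformation ((*v) R)"
    using c(3) by (simp add: orthogonal_transformation_matrix)
  then have ne: "norm e = 1" unfolding e_def by (simp add: orthogonal_transformation norm_axis_1)
  have "(\<chi> i. if i = k then 0 else axis k (1::real) $ i) = 0"
    by (simp add: vec_eq_iff axis_def)
  then have "norm (\<chi> i. if i = k then 0 else axis k (1::real) $ i) < \<theta> * \<bar>axis k 1 $ k\<bar>"
    using c by (simp only: norm_zero) (simp add: axis_def)
  then have "e \<in> cone k \<theta> R" unfolding cone_def e_def by (intro imageI) simp
  then obtain \<epsilon> where \<epsilon>: "\<epsilon> > 0" "ball e \<epsilon> \<subseteq> cone k \<theta> R"
    using open_cone[OF c(3)] by (meson openE)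
  \<comment> \<open>The cap 1/4 will separate the test balls from each other and from the ball of
    evaluation.\<close>
  define \<kappa> where "\<kappa> = min (\<epsilon> / 2) (1 / 4)"
  show thesis
  proof (rule that[of c e \<kappa>])
    fix x y s d assume s: "s > 0" "norm d < 2 * \<kappa>" "x - y = s *\<^sub>R (e + d)"
    then have "e + d \<in> ball e \<epsilon>" by (auto simp: \<kappa>_def dist_norm)
    then show "\<exists>a. K x y = of_real a \<and> c / norm (x - y) ^ CARD('n) \<le> a"
      using \<epsilon> s by (intro K) (auto intro: cone_scaleR)
  qed (use c ne \<epsilon> in \<open>auto simp: \<kappa>_def\<close>)
qed

section \<open>Comparison of the integral with a sum over radii in geometric progression\<close>

lemma nn_integral_le_geometric_sum:
  fixes \<psi> :: "real \<Rightarrow> real"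
  assumes r: "0 < r" "r \<le> R" and C: "0 \<le> C" and pos: "\<And>t. 0 < t \<Longrightarrow> 0 \<le> \<psi> t"
    and dec: "\<And>s t. 0 < s \<Longrightarrow> s \<le> t \<Longrightarrow> \<psi> t \<le> C * \<psi> s"
  shows "(\<integral>\<^sup>+ t\<in>{r<..}. ennreal (\<psi> t / t) \<partial>lebesgue)
    \<le> ennreal (4 * R / r * C * \<psi> r) + (\<Sum>j. ennreal (3 * C * \<psi> (4 ^ (j + 1) * R)))"
proof -
  have R: "R > 0" using r by simp
  \<comment> \<open>On \<open>I j\<close> the integrand is at most \<open>B j\<close>, by almost
    monotonicity from the left end point. The length of \<open>I j\<close> is three times that end
    point, which produces the factor 3.\<close>
  define I where "I j = {4 ^ (j + 1) * R..<4 ^ (j + 2) * R}" for j :: nat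
  define B where "B j = C * \<psi> (4 ^ (j + 1) * R) / (4 ^ (j + 1) * R)" for j :: nat
  have B: "B j \<ge> 0" for j using C R pos[of "4 ^ (j + 1) * R"] by (simp add: B_def)
  have pt: "ennreal (\<psi> t / t) * indicator {r<..} t \<le>
      ennreal (C * \<psi> r / r) * indicator {r..<4 * R} t + (\<Sum>j. ennreal (B j) * indicator (I j) t)" for t
  proof (cases "t > r")
    case t: True
    have le: "\<psi> t / t \<le> C * \<psi> s / s" if "0 < s" "s \<le> t" for s
      using that pos[of t] dec[of s t] by (intro frac_le) auto
    show ?thesis
    proof (cases "t < 4 * R")
      case True
      then show ?thesis using t le[of r] r by (auto intro!: add_increasing2 ennreal_leI)
    next
      case False
      \<comment> \<open>The first power above \<open>t / (4 * R)\<close> locates the interval; it is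
        not the zeroth power because \<open>t\<close> is at least \<open>4 * R\<close> here, so
        \<open>n\<close> has a predecessor \<open>j\<close>.\<close>
      define n where "n = (LEAST n. t / (4 * R) < 4 ^ n)"
      have ex: "\<exists>n. t / (4 * R) < 4 ^ n" by (rule real_arch_pow) simp
      have n1: "t / (4 * R) < 4 ^ n" unfolding n_def by (rule LeastI_ex[OF ex])
      have "n \<noteq> 0" using n1 False R by (auto simp: field_simps intro: ccontr)
      then obtain j where j: "n = Suc j" by (cases n) auto
      then have n2: "\<not> t / (4 * R) < 4 ^ j"
        using not_less_Least[of j "\<lambda>n. t / (4 * R) < 4 ^ n"] by (simp add: n_def)
      have tj: "t \<in> I j" using n1 n2 R unfolding j I_def by (auto simp: field_simps)
      have "ennreal (\<psi> t / t) * indicator {r<..} t \<le> ennreal (B j) * indicator (I j) t"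
        using t tj le[of "4 ^ (j + 1) * R"] R by (auto simp: B_def I_def intro!: ennreal_leI)
      also have "\<dots> \<le> (\<Sum>i. ennreal (B i) * indicator (I i) t)" by (rule ennreal_le_suminf)
      finally show ?thesis by (auto intro: add_increasing)
    qed
  qed simp
  have "(\<integral>\<^sup>+ t\<in>{r<..}. ennreal (\<psi> t / t) \<partial>lebesgue) \<le>
      (\<integral>\<^sup>+ t. ennreal (C * \<psi> r / r) * indicator {r..<4 * R} t + (\<Sum>j. ennreal (B j) * indicator (I j) t) \<partial>lebesgue)"
    by (intro nn_integral_mono pt)
  also have "\<dots> = ennreal (C * \<psi> r / r) * emeasure lebesgue {r..<4 * R} +
      (\<Sum>j. ennreal (B j) * emeasure lebesgue (I j))"
  proof -
    have [measurable]: "I j \<in> sets lebesgue" for j by (simp add: I_def)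
    have [measurable]: "{r..<4 * R} \<in> sets lebesgue" by simp
    have "(\<integral>\<^sup>+ t. ennreal (C * \<psi> r / r) * indicator {r..<4 * R} t +
          (\<Sum>j. ennreal (B j) * indicator (I j) t) \<partial>lebesgue) =
        (\<integral>\<^sup>+ t. ennreal (C * \<psi> r / r) * indicator {r..<4 * R} t \<partial>lebesgue) +
        (\<integral>\<^sup>+ t. (\<Sum>j. ennreal (B j) * indicator (I j) t) \<partial>lebesgue)"
      by (rule nn_integral_add) measurable
    also have "(\<integral>\<^sup>+ t. (\<Sum>j. ennreal (B j) * indicator (I j) t) \<partial>lebesgue) =
        (\<Sum>j. \<integral>\<^sup>+ t. ennreal (B j) * indicator (I j) t \<partial>lebesgue)"
      by (rule nn_integral_suminf) measurable
    also have "\<dots> = (\<Sum>j. ennreal (B j) * emeasure lebesgue (I j))"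
      by (intro suminf_cong nn_integral_cmult_indicator) measurable
    also have "(\<integral>\<^sup>+ t. ennreal (C * \<psi> r / r) * indicator {r..<4 * R} t \<partial>lebesgue) =
        ennreal (C * \<psi> r / r) * emeasure lebesgue {r..<4 * R}"
      by (rule nn_integral_cmult_indicator) measurable
    finally show ?thesis .
  qed
  also have "\<dots> \<le> ennreal (4 * R / r * C * \<psi> r) + (\<Sum>j. ennreal (3 * C * \<psi> (4 ^ (j + 1) * R)))"
  proof (intro add_mono suminf_le)
    have "C * \<psi> r / r * (4 * R - r) \<le> C * \<psi> r / r * (4 * R)"
      using r C pos[of r] by (intro mult_left_mono) auto
    then show "ennreal (C * \<psi> r / r) * emeasure lebesgue {r..<4 * R} \<le> ennreal (4 * R / r * C * \<psi> r)"
      using r C pos[of r] by (simp add: mult_ac ennreal_leI flip: ennreal_mult)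
    show "ennreal (B j) * emeasure lebesgue (I j) \<le> ennreal (3 * C * \<psi> (4 ^ (j + 1) * R))" for j
    proof -
      have "emeasure lebesgue (I j) = ennreal (3 * (4 ^ (j + 1) * R))"
        using R by (simp add: I_def algebra_simps)
      then have "ennreal (B j) * emeasure lebesgue (I j) = ennreal (B j * (3 * (4 ^ (j + 1) * R)))"
        using B[of j] R by (simp add: ennreal_mult)
      also have "B j * (3 * (4 ^ (j + 1) * R)) = 3 * C * \<psi> (4 ^ (j + 1) * R)"
        using R by (simp add: B_def)
      finally show ?thesis by simp
    qed
  qed auto
  finally show ?thesis .
qed

theorem theorem4p15:
  fixes \<Phi> :: "real \<Rightarrow> ennreal"
    and w :: "real ^ 'n \<Rightarrow> real"
    and \<phi>1 \<phi>2 :: "real ^ 'n \<Rightarrow> real \<Rightarrow> real"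
    and T :: "(real ^ 'n \<Rightarrow> 'k::{real_normed_field, euclidean_space}) \<Rightarrow> (real ^ 'n \<Rightarrow> 'k)"
    and K :: "real ^ 'n \<Rightarrow> real ^ 'n \<Rightarrow> 'k"
  assumes "young_function \<Phi>" and "nabla2 \<Phi>"
    and "muckenhoupt (lower_dilation_index \<Phi>) w"
    and "positive_measurable \<phi>1" and "positive_measurable \<phi>2"
    and "\<phi>1 \<in> class_G \<Phi> w"
    and "\<exists>C>0. \<forall>x. \<forall>r>0. \<phi>1 x r \<le> C * \<phi>2 x r"
    and "calderon_zygmund T K" and "genuine_kernel K"
    and "cz_bounded_morrey T K \<Phi> w \<phi>1 \<phi>2"
  shows "\<exists>C>0. \<forall>x. \<forall>r>0.
           (\<integral>\<^sup>+ t\<in>{r<..}. ennreal (\<phi>1 x t / t) \<partial>lebesgue) \<le> ennreal (C * \<phi>2 x r)"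
proof -
  have Y: "young_function \<Phi>" by fact
  have Mu: "muckenhoupt (lower_dilation_index \<Phi>) w" by fact
  have T: "bounded_linear_L2 T" using assms(8) by (simp add: calderon_zygmund_def)
  have pos1: "\<phi>1 x r > 0" if "r > 0" for x r using assms(4) that by (simp add: positive_measurable_def)
  have pos2: "\<phi>2 x r > 0" if "r > 0" for x r using assms(5) that by (simp add: positive_measurable_def)
  obtain D where D: "D > 0" "\<And>x r. r > 0 \<Longrightarrow> \<phi>1 x r \<le> D * \<phi>2 x r" using assms(7) by blast
  obtain A where A: "A > 0" "\<And>x r r0. r > 0 \<Longrightarrow> r \<le> r0 \<Longrightarrow> \<phi>1 x r0 \<le> A * \<phi>1 x r"
    using assms(6) unfolding class_G_def by fastforce
  obtain c e \<kappa> where c: "c > 0" and e: "norm e = 1" and \<kappa>: "0 < \<kappa>" "\<kappa> \<le> 1 / 4"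
    and K: "\<And>x y s d. s > 0 \<Longrightarrow> norm d < 2 * \<kappa> \<Longrightarrow> x - y = s *\<^sub>R (e + d) \<Longrightarrow>
       \<exists>a. K x y = of_real a \<and> c / norm (x - y) ^ CARD('n) \<le> a"
    proof (rule genuine_kernel_direction[OF assms(9)], goal_cases)
    case 1
    from 1(2-) show thesis by (rule that)
  qed
  obtain \<Lambda> where \<Lambda>: "\<Lambda> > 0" and test: "\<And>R Q x (f :: real ^ 'n \<Rightarrow> 'k).
    R > 0 \<Longrightarrow> (\<And>j. Q j \<in> sets lebesgue) \<Longrightarrow> (\<And>j. Q j \<subseteq> ball x (2 ^ (j + 2) * R)) \<Longrightarrow>
    f \<in> borel_measurable lebesgue \<Longrightarrow>
    (\<And>y. f y \<noteq> 0 \<Longrightarrow> \<exists>j. y \<in> Q j \<and> norm (f y) \<le> \<phi>1 x (4 ^ (j + 1) * R)) \<Longrightarrow>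
    f \<in> morrey_space \<Phi> \<phi>1 w \<and> morrey_norm \<Phi> \<phi>1 w f \<le> ennreal \<Lambda>"
    proof (rule morrey_norm_lacunary[OF Y Mu assms(6), where 'k = 'k], goal_cases)
    case 1
    from 1(2-) show thesis by (rule that)
  qed
  obtain B where B: "B \<ge> 0" "\<And>f. f \<in> morrey_space \<Phi> \<phi>1 w \<Longrightarrow> \<exists>F. cz_image T K f F \<and>
        morrey_norm \<Phi> \<phi>2 w F \<le> ennreal B * morrey_norm \<Phi> \<phi>1 w f"
    using assms(10) unfolding cz_bounded_morrey_def by blast
  \<comment> \<open>Kernel bound \<open>c / (2 * \<rho> j)^n\<close> times the volume of a ball of
    radius \<open>\<kappa> * \<rho> j\<close>, with \<open>n\<close> the dimension: the radii
    cancel, so every test ball contributes the same constant.\<close>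
  define c0 where "c0 = c * unit_ball_vol (CARD('n)) * (\<kappa> / 2) ^ CARD('n)"
  have c0: "c0 > 0" using c \<kappa> by (simp add: c0_def)

  \<comment> \<open>Testing the operator: partial sums bounded uniformly in their length\<close>
  have sum_le: "c0 * (\<Sum>j<N. \<phi>1 x (4 ^ (j + 1) * (r / \<kappa>))) \<le> B * \<Lambda> * \<phi>2 x r" if r: "r > 0" for x r N
  proof -
    define R where "R = r / \<kappa>"
    have R: "R > 0" "r = \<kappa> * R" using r \<kappa> by (auto simp: R_def)
    \<comment> \<open>Indices start at 0, so the smallest distance is \<open>2 * R\<close>. As
      \<open>r = \<kappa> * R\<close>, a displacement inside \<open>ball x r\<close> is then below
      \<open>\<kappa> * \<rho> j\<close> for every \<open>j\<close>.\<close>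
    define \<rho> where "\<rho> j = 2 ^ (j + 1) * R" for j :: nat
    have \<rho>: "\<rho> j > 0" "2 * R \<le> \<rho> j" for j using R by (auto simp: \<rho>_def)
    define Q where "Q j = ball (x - \<rho> j *\<^sub>R e) (\<kappa> * \<rho> j)" for j
    define b where "b j = \<phi>1 x (4 ^ (j + 1) * R)" for j :: nat
    have b: "b j > 0" for j using R by (simp add: b_def pos1)
    have QD: "3 / 4 * \<rho> j < norm (y - x)" "norm (y - x) < 5 / 4 * \<rho> j" if "y \<in> Q j" for y j
    proof -
      have 1: "norm (y - (x - \<rho> j *\<^sub>R e)) < \<kappa> * \<rho> j"
        using that by (simp add: Q_def dist_norm norm_minus_commute)
      have 2: "\<kappa> * \<rho> j \<le> 1 / 4 * \<rho> j" using \<kappa> \<rho>(1)[of j] by (intro mult_right_mono) auto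
      have 3: "norm (\<rho> j *\<^sub>R e) = \<rho> j" using \<rho>(1)[of j] e by simp
      have "norm (y - x) \<le> norm (y - (x - \<rho> j *\<^sub>R e)) + norm (\<rho> j *\<^sub>R e)"
        using norm_triangle_ineq4[of "y - (x - \<rho> j *\<^sub>R e)" "\<rho> j *\<^sub>R e"] by simp
      with 1 2 3 show "norm (y - x) < 5 / 4 * \<rho> j" by linarith
      have "norm (\<rho> j *\<^sub>R e) \<le> norm (y - (x - \<rho> j *\<^sub>R e)) + norm (y - x)"
        using norm_triangle_ineq4[of "y - (x - \<rho> j *\<^sub>R e)" "y - x"] by simp
      with 1 2 3 show "3 / 4 * \<rho> j < norm (y - x)" by linarith
    qed
    have dbl: "2 * \<rho> i \<le> \<rho> j" if "i < j" for i j
    proof -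
      have "(2::real) ^ (i + 2) \<le> 2 ^ (j + 1)" using that by (intro power_increasing) auto
      then show ?thesis using R by (simp add: \<rho>_def)
    qed
    \<comment> \<open>The test balls lie in disjoint shells: \<open>\<rho>\<close> at least doubles,
      and \<open>5/4\<close> is less than twice \<open>3/4\<close>.\<close>
    have inj: "i = j" if "y \<in> Q i" "y \<in> Q j" for y i j
      using QD[OF that(1)] QD[OF that(2)] dbl[of i j] dbl[of j i] \<rho>(1)[of i] \<rho>(1)[of j]
      by (cases i j rule: linorder_cases) auto
    have single: "(\<Sum>i. v i * indicator (Q i) y) = v j" if "y \<in> Q j" for v :: "nat \<Rightarrow> real" and y j
    proof -
      have "(\<Sum>i. v i * indicator (Q i) y) = (\<Sum>i\<in>{j}. v i * indicator (Q i) y)"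
        by (rule suminf_finite) (use inj[OF that] in \<open>auto simp: indicator_def\<close>)
      then show ?thesis using that by simp
    qed
    have single': "(\<Sum>i. v i * indicator (Q i) y) = v j" if "y \<in> Q j" for v :: "nat \<Rightarrow> ennreal" and y j
    proof -
      have "(\<Sum>i. v i * indicator (Q i) y) = (\<Sum>i\<in>{j}. v i * indicator (Q i) y)"
        by (rule suminf_finite) (use inj[OF that] in \<open>auto simp: indicator_def\<close>)
      then show ?thesis using that by simp
    qed
    \<comment> \<open>At most one term is nonzero at each point; the form as a series gives
      measurability.\<close>
    define g where "g y = (\<Sum>j. b j * indicator (Q j) y)" for y
    have gQ: "g y = b j" if "y \<in> Q j" for y j unfolding g_def using that by (rule single)
    have g0: "g y = 0" if "\<And>j. y \<notin> Q j" for y using that by (simp add: g_def)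
    have g_nonneg: "0 \<le> g y" for y using gQ[of y] g0[of y] b by (metis less_imp_le order_refl)
    have [measurable]: "Q j \<in> sets lebesgue" for j unfolding Q_def by measurable
    have [measurable]: "g \<in> borel_measurable lebesgue" unfolding g_def[abs_def] by measurable
    have f_meas: "(\<lambda>y. of_real (g y) :: 'k) \<in> borel_measurable lebesgue" by measurable
    have Q_sub: "Q j \<subseteq> ball x (2 ^ (j + 2) * R)" for j
    proof
      fix y assume "y \<in> Q j"
      from QD(2)[OF this] \<rho>(1)[of j] have "norm (y - x) < 2 * \<rho> j" by linarith
      then show "y \<in> ball x (2 ^ (j + 2) * R)"
        by (simp add: dist_norm norm_minus_commute \<rho>_def)
    qed
    have f_bound: "\<exists>j. y \<in> Q j \<and> norm (of_real (g y) :: 'k) \<le> \<phi>1 x (4 ^ (j + 1) * R)"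
      if "of_real (g y) \<noteq> (0 :: 'k)" for y
    proof -
      obtain j where "y \<in> Q j" using \<open>of_real (g y) \<noteq> (0 :: 'k)\<close> g0[of y] by auto
      then show ?thesis using gQ[of y j] b[of j] by (intro exI[of _ j]) (simp add: b_def)
    qed
    have f: "(\<lambda>y. of_real (g y) :: 'k) \<in> morrey_space \<Phi> \<phi>1 w"
      "morrey_norm \<Phi> \<phi>1 w (\<lambda>y. of_real (g y) :: 'k) \<le> ennreal \<Lambda>"
      using test[OF R(1) _ Q_sub f_meas f_bound] by auto
    obtain F where F: "cz_image T K (\<lambda>y. of_real (g y)) F"
      "morrey_norm \<Phi> \<phi>2 w F \<le> ennreal B * morrey_norm \<Phi> \<phi>1 w (\<lambda>y. of_real (g y) :: 'k)"
      using B(2)[OF f(1)] by blast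
    have Kz: "\<exists>a\<ge>0. K z y = of_real a \<and> c / (2 * \<rho> j) ^ CARD('n) \<le> a"
      if z: "z \<in> ball x r" and y: "y \<in> Q j" for z y j
    proof -
      \<comment> \<open>The deviation of \<open>z - y\<close> from
        \<open>\<rho> j *\<^sub>R e\<close>: the displacement of \<open>z\<close> from
        \<open>x\<close> minus that of \<open>y\<close> from the centre of
        \<open>Q j\<close>.\<close>
      define u where "u = (z - x) - (y - (x - \<rho> j *\<^sub>R e))"
      define d where "d = (1 / \<rho> j) *\<^sub>R u"
      have "norm u \<le> norm (z - x) + norm (y - (x - \<rho> j *\<^sub>R e))"
        unfolding u_def by (rule norm_triangle_ineq4)
      also have "\<dots> < \<kappa> * R + \<kappa> * \<rho> j"
        using y z R by (auto simp: Q_def dist_norm norm_minus_commute intro: add_strict_mono)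
      also have "\<dots> \<le> \<kappa> * \<rho> j + \<kappa> * \<rho> j" using \<rho>(2)[of j] R \<kappa> by simp
      finally have "norm u < 2 * \<kappa> * \<rho> j" by simp
      moreover have "norm d = norm u / \<rho> j" using \<rho>(1)[of j] by (simp add: d_def)
      ultimately have d: "norm d < 2 * \<kappa>"
        using \<rho>(1)[of j] by (simp add: pos_divide_less_eq)
      have zy: "z - y = \<rho> j *\<^sub>R (e + d)"
        using \<rho>(1)[of j] by (simp add: d_def u_def scaleR_add_right)
      obtain a where a: "K z y = of_real a" "c / norm (z - y) ^ CARD('n) \<le> a"
        using K[OF \<rho>(1) d zy] by blast
      have "norm (e + d) \<le> 2" using norm_triangle_ineq[of e d] e d \<kappa> by simp
      then have "norm (z - y) \<le> 2 * \<rho> j" unfolding zy using \<rho>(1)[of j] by simp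
      moreover have "1 \<le> norm (e + d) + norm d"
        using norm_triangle_ineq4[of "e + d" d] e by simp
      then have "norm (e + d) > 0" using d \<kappa> by linarith
      then have "norm (z - y) > 0" unfolding zy using \<rho>(1)[of j] by simp
      ultimately have "c / (2 * \<rho> j) ^ CARD('n) \<le> c / norm (z - y) ^ CARD('n)"
        using c \<rho>(1)[of j] by (intro divide_left_mono power_mono mult_pos_pos zero_less_power) auto
      with a have "c / (2 * \<rho> j) ^ CARD('n) \<le> a" by simp
      moreover have "0 \<le> c / (2 * \<rho> j) ^ CARD('n)" using c \<rho>(1)[of j] by simp
      ultimately show ?thesis using a by (intro exI[of _ a]) auto
    qed
    have lower: "ennreal (c0 * (\<Sum>j<N. b j)) \<le> (\<integral>\<^sup>+ y. ennreal (norm (K z y) * g y) \<partial>lebesgue)"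
      if z: "z \<in> ball x r" for z
    proof -
      have vol: "ennreal (c / (2 * \<rho> j) ^ CARD('n) * b j) * emeasure lebesgue (Q j) = ennreal (c0 * b j)" for j
      proof -
        have "emeasure lebesgue (Q j) = ennreal (unit_ball_vol (CARD('n)) * (\<kappa> * \<rho> j) ^ CARD('n))"
          unfolding Q_def using \<kappa> \<rho>(1)[of j] by (intro emeasure_lebesgue_ball) simp
        moreover have "0 \<le> unit_ball_vol (CARD('n)) * (\<kappa> * \<rho> j) ^ CARD('n)"
          using \<kappa> \<rho>(1)[of j] by simp
        ultimately have "ennreal (c / (2 * \<rho> j) ^ CARD('n) * b j) * emeasure lebesgue (Q j) =
          ennreal (c / (2 * \<rho> j) ^ CARD('n) * b j * (unit_ball_vol (CARD('n)) * (\<kappa> * \<rho> j) ^ CARD('n)))"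
          by (simp only: ennreal_mult''[symmetric])
        also have "c / (2 * \<rho> j) ^ CARD('n) * b j * (unit_ball_vol (CARD('n)) * (\<kappa> * \<rho> j) ^ CARD('n)) = c0 * b j"
          using \<rho>(1)[of j] by (simp add: c0_def field_simps power_mult_distrib power_divide)
        finally show ?thesis .
      qed
      have "ennreal (c0 * (\<Sum>j<N. b j)) = (\<Sum>j<N. ennreal (c0 * b j))"
        using c0 b by (simp add: sum_distrib_left sum_ennreal less_imp_le)
      also have "\<dots> \<le> (\<Sum>j. ennreal (c0 * b j))" by (rule sum_le_suminf) auto
      also have "\<dots> = (\<Sum>j. ennreal (c / (2 * \<rho> j) ^ CARD('n) * b j) * emeasure lebesgue (Q j))"
        by (simp only: vol)
      also have "\<dots> = (\<integral>\<^sup>+ y. (\<Sum>j. ennreal (c / (2 * \<rho> j) ^ CARD('n) * b j) * indicator (Q j) y) \<partial>lebesgue)"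
        by (subst nn_integral_suminf) (measurable, simp add: nn_integral_cmult_indicator)
      also have "\<dots> \<le> (\<integral>\<^sup>+ y. ennreal (norm (K z y) * g y) \<partial>lebesgue)"
      proof (rule nn_integral_mono)
        fix y
        show "(\<Sum>j. ennreal (c / (2 * \<rho> j) ^ CARD('n) * b j) * indicator (Q j) y) \<le> ennreal (norm (K z y) * g y)"
        proof (cases "\<exists>j. y \<in> Q j")
          case True
          then obtain j where j: "y \<in> Q j" by blast
          obtain a where a: "a \<ge> 0" "K z y = of_real a" "c / (2 * \<rho> j) ^ CARD('n) \<le> a" using Kz[OF z j] by blast
          have "c / (2 * \<rho> j) ^ CARD('n) * b j \<le> a * b j"
            using a b[of j] by (intro mult_right_mono) auto
          then show ?thesis unfolding single'[OF j] gQ[OF j] using a by (simp add: ennreal_leI)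
        qed simp
      qed
      finally show ?thesis .
    qed
    \<comment> \<open>Points of \<open>Q j\<close> are farther than \<open>3/2 * R\<close> from
      \<open>x\<close>, while \<open>2 * r\<close> is at most \<open>R / 2\<close>. Hence the local
      part of the operator sees only 0.\<close>
    have vanish: "g y = 0" if y: "y \<in> ball x (2 * r)" for y
    proof (rule g0, rule notI)
      fix j assume "y \<in> Q j"
      from QD(1)[OF this] \<rho>(2)[of j] have "3 / 2 * R < norm (y - x)" by simp
      moreover have "2 * r \<le> 1 / 2 * R" using \<kappa> R by simp
      moreover have "norm (y - x) < 2 * r" using y by (simp add: dist_norm norm_minus_commute)
      ultimately show False using R(1) by linarith
    qed
    have "AE z in lebesgue. z \<in> ball x r \<longrightarrow>
           ennreal (norm (F z)) = (\<integral>\<^sup>+ y. ennreal (norm (K z y) * g y) \<partial>lebesgue)"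
    proof (rule cz_image_eq_nn_integral[OF T r g_nonneg F(1) vanish])
      fix z y assume "z \<in> ball x r" "g y \<noteq> 0"
      then show "\<exists>a\<ge>0. K z y = of_real a" using g0[of y] Kz[of z y] by blast
    qed
    \<comment> \<open>The exact value of \<open>norm (F z)\<close> is an integral of nonnegative
      terms, bounded below by the contributions of the first \<open>N\<close> test balls.\<close>
    then have "AE z in lebesgue. z \<in> ball x r \<longrightarrow> c0 * (\<Sum>j<N. b j) \<le> norm (F z)"
    proof eventually_elim
      case (elim z)
      then show ?case using lower[of z] by (auto simp flip: ennreal_le_iff)
    qed
    then have *: "ennreal (c0 * (\<Sum>j<N. b j)) \<le>
        young_inv \<Phi> (inverse (wmeas w (ball x r))) * orlicz_norm \<Phi> w (restr (ball x r) F)"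
      using c0 b by (intro young_inv_mult_orlicz_norm_ge[OF Y Mu r])
        (auto intro!: sum_nonneg mult_nonneg_nonneg simp: less_imp_le)
    have "ennreal (inverse (\<phi>2 x r)) * ennreal (c0 * (\<Sum>j<N. b j)) \<le>
        ennreal (inverse (\<phi>2 x r)) * young_inv \<Phi> (inverse (wmeas w (ball x r))) *
          orlicz_norm \<Phi> w (restr (ball x r) F)"
      using * by (simp add: mult.assoc mult_left_mono)
    also have "\<dots> \<le> morrey_norm \<Phi> \<phi>2 w F"
      unfolding morrey_norm_def using r by (intro SUP_upper2[of "(x, r)"]) auto
    also have "\<dots> \<le> ennreal B * ennreal \<Lambda>"
      using F(2) f(2) by (meson mult_left_mono order_trans zero_le)
    finally have "inverse (\<phi>2 x r) * (c0 * (\<Sum>j<N. b j)) \<le> B * \<Lambda>"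
      using B(1) \<Lambda> c0 b pos2[OF r, of x]
      by (simp add: sum_nonneg less_imp_le flip: ennreal_mult)
    then show ?thesis using pos2[OF r, of x] by (simp add: b_def R_def field_simps)
  qed

  \<comment> \<open>From partial sums to the integral\<close>
  define C where "C = 4 / \<kappa> * A * D + 3 * A * (B * \<Lambda> / c0)"
  have "C > 0" using \<kappa> A D B \<Lambda> c0 by (auto simp: C_def intro!: add_pos_nonneg)
  moreover have "(\<integral>\<^sup>+ t\<in>{r<..}. ennreal (\<phi>1 x t / t) \<partial>lebesgue) \<le> ennreal (C * \<phi>2 x r)" if r: "r > 0" for x r
  proof -
    have "r \<le> r / \<kappa>" using r \<kappa> by (simp add: field_simps)
    then have "(\<integral>\<^sup>+ t\<in>{r<..}. ennreal (\<phi>1 x t / t) \<partial>lebesgue)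
      \<le> ennreal (4 * (r / \<kappa>) / r * A * \<phi>1 x r) + (\<Sum>j. ennreal (3 * A * \<phi>1 x (4 ^ (j + 1) * (r / \<kappa>))))"
      using r A pos1 by (intro nn_integral_le_geometric_sum) (auto simp: less_imp_le)
    \<comment> \<open>The initial piece, up to \<open>4 * r / \<kappa>\<close>, is controlled by the
      pointwise bound of \<open>\<phi>1\<close> by \<open>\<phi>2\<close>; the series is controlled
      by \<open>sum_le\<close>, whose bound does not depend on \<open>N\<close>.\<close>
    also have "\<dots> \<le> ennreal (4 / \<kappa> * A * D * \<phi>2 x r) + ennreal (3 * A * (B * \<Lambda> / c0) * \<phi>2 x r)"
    proof (intro add_mono suminf_le_const summableI)
      have "4 / \<kappa> * A * \<phi>1 x r \<le> 4 / \<kappa> * A * (D * \<phi>2 x r)"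
        using D(2)[OF r, of x] \<kappa> A by (intro mult_left_mono) auto
      then show "ennreal (4 * (r / \<kappa>) / r * A * \<phi>1 x r) \<le> ennreal (4 / \<kappa> * A * D * \<phi>2 x r)"
        using r by (intro ennreal_leI) (simp add: mult_ac)
      fix N
      have pos: "0 \<le> \<phi>1 x (4 ^ (j + 1) * (r / \<kappa>))" for j :: nat
        using pos1[of "4 ^ (j + 1) * (r / \<kappa>)" x] r \<kappa> by simp
      have "(\<Sum>j<N. ennreal (3 * A * \<phi>1 x (4 ^ (j + 1) * (r / \<kappa>)))) =
          ennreal (3 * A * (\<Sum>j<N. \<phi>1 x (4 ^ (j + 1) * (r / \<kappa>))))"
        using A pos by (subst sum_ennreal) (auto simp: sum_distrib_left)
      also have "\<dots> \<le> ennreal (3 * A * (B * \<Lambda> * \<phi>2 x r / c0))"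
        using sum_le[OF r, of x N] c0 A
        by (intro ennreal_leI mult_left_mono) (auto simp: field_simps)
      finally show "(\<Sum>j<N. ennreal (3 * A * \<phi>1 x (4 ^ (j + 1) * (r / \<kappa>)))) \<le>
          ennreal (3 * A * (B * \<Lambda> / c0) * \<phi>2 x r)" by (simp add: mult_ac)
    qed
    also have "\<dots> = ennreal (C * \<phi>2 x r)"
      using A B \<Lambda> D c0 \<kappa> pos2[OF r, of x] by (simp add: C_def distrib_right flip: ennreal_plus)
    finally show ?thesis .
  qed
  ultimately show ?thesis by blast
qed

end
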